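(* Let $W=(W_s:0\le s\le1)$ be a standard Brownian motion from $0$ and let $\Theta$ denote the almost surely unique time at which $W$ attains its maximum over $[0,1]$. Let $\mathfrak{a}$ be the Brownian ascent. Then $$(\mathfrak{a}_s:0\le s\le1)\stackrel{\mathcal{L}}{=}\left(\frac{W_{s\Theta}}{\sqrt\Theta}:0\le s\le1\right).$$
   Context: The Brownian ascent $\mathfrak{a}=(\mathfrak{a}_s:0\le s\le1)$ is Brownian motion on $[0,1]$ from $0$ conditioned to end at its maximum: with $X$ a standard Brownian motion from $0$ under $P_0$ and $S_1=\sup_{s\le1}X_s$, its law is the weak limit, as $\epsilon\searrow0$, of the law of $(X_s:0\le s\le1)$ under $P_0(\,\cdot\mid S_1-X_1<\epsilon)$ on $\mathcal{C}([0,1];\mathbb{R})$ with the uniform topology. $\stackrel{\mathcal{L}}{=}$ denotes equality in law. *)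

theory Defs
  imports "HOL-Probability.Probability"
begin

typedef unit_interval = "{0..1::real}"
  morphisms of_unit to_unit
  by auto

instantiation unit_interval :: metric_space
begin

definition dist_unit_interval :: "unit_interval \<Rightarrow> unit_interval \<Rightarrow> real"
  where "dist_unit_interval s t = dist (of_unit s) (of_unit t)"

definition uniformity_unit_interval :: "(unit_interval \<times> unit_interval) filter"
  where "uniformity_unit_interval = (INF e\<in>{0 <..}. principal {(s, t). dist s t < e})"

definition open_unit_interval :: "unit_interval set \<Rightarrow> bool"
  where "open_unit_interval U = (\<forall>s\<in>U. \<forall>\<^sub>F (s', t) in uniformity. s' = s \<longrightarrow> t \<in> U)"

instance
proof
  fix s t u :: unit_interval
  show "dist s t = 0 \<longleftrightarrow> s = t"
    by (simp add: dist_unit_interval_def of_unit_inject)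
  show "dist s t \<le> dist s u + dist t u"
    by (simp add: dist_unit_interval_def dist_triangle2)
qed (rule uniformity_unit_interval_def open_unit_interval_def)+

end

lemma of_unit_mem: "of_unit s \<in> {0..1}"
  by (rule of_unit)

lemma continuous_on_of_unit: "continuous_on UNIV of_unit"
  by (auto simp: continuous_on_iff dist_unit_interval_def)

lemma range_of_unit: "range of_unit = {0..1}"
  by (auto simp: type_definition.Rep_range[OF type_definition_unit_interval])

text \<open>
  As \<open>[0,1]\<close> is compact, \<open>C([0,1];\<real>)\<close> with the uniform topology is the metric space
  \<^typ>\<open>unit_interval \<Rightarrow>\<^sub>C real\<close> of bounded continuous functions with the supremum distance.
\<close>

lemma bcontfun_unit_interval:
  fixes f :: "real \<Rightarrow> real"
  assumes "continuous_on {0..1} f"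
  shows "(\<lambda>s. f (of_unit s)) \<in> bcontfun"
proof -
  have "continuous_on UNIV (\<lambda>s. f (of_unit s))"
    using continuous_on_compose[OF continuous_on_of_unit, of f] assms
    by (simp add: range_of_unit o_def)
  moreover have "bounded (f ` {0..1})"
    using assms compact_continuous_image compact_imp_bounded by blast
  moreover have "range (\<lambda>s. f (of_unit s)) = f ` {0..1}"
    by (metis image_image range_of_unit)
  ultimately show ?thesis
    by (simp add: bcontfun_def)
qed

text \<open>
  The path \<open>s \<mapsto> X s \<omega>\<close> restricted to \<open>[0,1]\<close>; meaningful only where this path is continuous
  (\<^const>\<open>Bcontfun\<close> is unspecified on other functions).
\<close>

definition sample_path :: "(real \<Rightarrow> 'a \<Rightarrow> real) \<Rightarrow> 'a \<Rightarrow> (unit_interval \<Rightarrow>\<^sub>C real)"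
  where "sample_path X \<omega> = Bcontfun (\<lambda>s. X (of_unit s) \<omega>)"

lemma sample_path_apply:
  assumes "continuous_on {0..1} (\<lambda>s. X s \<omega>)"
  shows "apply_bcontfun (sample_path X \<omega>) s = X (of_unit s) \<omega>"
  using bcontfun_unit_interval[OF assms]
  by (simp add: sample_path_def Bcontfun_inverse)

locale continuous_process = prob_space M
  for M :: "'a measure" and X :: "real \<Rightarrow> 'a \<Rightarrow> real" +
  assumes measurable_process: "\<And>s. s \<in> {0..1} \<Longrightarrow> X s \<in> borel_measurable M"
    and continuous_paths: "\<And>\<omega>. \<omega> \<in> space M \<Longrightarrow> continuous_on {0..1} (\<lambda>s. X s \<omega>)"

definition path_law :: "'a measure \<Rightarrow> (real \<Rightarrow> 'a \<Rightarrow> real) \<Rightarrow> (unit_interval \<Rightarrow>\<^sub>C real) measure"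
  where "path_law M X = distr M borel (sample_path X)"

text \<open>
  The path of a continuous process is a Borel random element of \<open>C([0,1];\<real>)\<close>, so that
  \<^const>\<open>path_law\<close> is indeed the image measure. The proof uses that the Bernstein polynomials
  with rational coefficients are dense.
\<close>

definition rational_Bernstein :: "rat list \<Rightarrow> (unit_interval \<Rightarrow>\<^sub>C real)"
  where "rational_Bernstein qs =
    Bcontfun (\<lambda>s. \<Sum>k\<le>length qs - 1. of_rat (qs ! k) * Bernstein (length qs - 1) k (of_unit s))"

lemma rational_Bernstein_apply:
  "apply_bcontfun (rational_Bernstein qs) s =
    (\<Sum>k\<le>length qs - 1. of_rat (qs ! k) * Bernstein (length qs - 1) k (of_unit s))"
proof -
  have "continuous_on {0..1} (\<lambda>x::real. \<Sum>k\<le>length qs - 1.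
      of_rat (qs ! k) * Bernstein (length qs - 1) k x)"
    unfolding Bernstein_def by (intro continuous_intros)
  from bcontfun_unit_interval[OF this] show ?thesis
    by (simp add: rational_Bernstein_def Bcontfun_inverse)
qed

lemma rational_Bernstein_dense:
  fixes f :: "unit_interval \<Rightarrow>\<^sub>C real"
  assumes "e > 0"
  shows "\<exists>qs. dist (rational_Bernstein qs) f < e"
proof -
  define g where "g x = apply_bcontfun f (to_unit x)" for x
  have ts: "continuous_on {0..1} to_unit"
    by (auto simp: continuous_on_iff dist_unit_interval_def to_unit_inverse)
  have "continuous_on {0..1} g"
    unfolding g_def
    by (rule continuous_on_compose2[OF continuous_on_apply_bcontfun[of UNIV f] ts]) auto
  from Bernstein_Weierstrass[OF this, of "e/4"] assms obtain n where
    "\<forall>m x. n \<le> m \<and> x \<in> {0..1} \<longrightarrow>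
      \<bar>g x - (\<Sum>k\<le>m. g (k/m) * Bernstein m k x)\<bar> < e/4"
    by auto
  then have n: "\<bar>g x - (\<Sum>k\<le>n. g (k/n) * Bernstein n k x)\<bar> < e/4" if "x \<in> {0..1}" for x
    using that by blast
  have "\<exists>q::rat. \<bar>of_rat q - y\<bar> < e/4" for y :: real
  proof -
    have "y - e/4 < y + e/4" using assms by simp
    from of_rat_dense[OF this] obtain q :: rat where "y - e/4 < of_rat q" "of_rat q < y + e/4"
      by blast
    then show ?thesis by (intro exI[of _ q]) linarith
  qed
  then obtain q :: "real \<Rightarrow> rat" where q: "\<And>y. \<bar>of_rat (q y) - y\<bar> < e/4" by metis
  define qs where "qs = map (\<lambda>k. q (g (real k / real n))) [0..<Suc n]"
  have len: "length qs - 1 = n" and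
    nth: "\<And>k. k \<le> n \<Longrightarrow> qs ! k = q (g (real k / real n))"
    by (auto simp: qs_def simp del: upt_Suc)
  have "dist (apply_bcontfun (rational_Bernstein qs) s) (apply_bcontfun f s) \<le> e/2" for s
  proof -
    let ?x = "of_unit s"
    have x: "?x \<in> {0..1}" by (rule of_unit_mem)
    have B: "0 \<le> Bernstein n k ?x" for k
      using x by (auto simp: Bernstein_def)
    have "\<bar>(\<Sum>k\<le>n. of_rat (qs ! k) * Bernstein n k ?x) - (\<Sum>k\<le>n. g (k/n) * Bernstein n k ?x)\<bar>
        = \<bar>\<Sum>k\<le>n. (of_rat (qs ! k) - g (k/n)) * Bernstein n k ?x\<bar>"
      by (simp add: sum_subtractf left_diff_distrib)
    also have "\<dots> \<le> (\<Sum>k\<le>n. \<bar>(of_rat (qs ! k) - g (k/n)) * Bernstein n k ?x\<bar>)"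
      by (rule sum_abs)
    also have "\<dots> \<le> (\<Sum>k\<le>n. e/4 * Bernstein n k ?x)"
    proof (rule sum_mono)
      fix k assume "k \<in> {..n}"
      then have "\<bar>of_rat (qs ! k) - g (k/n)\<bar> \<le> e/4"
        using q[of "g (k/n)"] by (simp add: nth less_imp_le)
      then show "\<bar>(of_rat (qs ! k) - g (k/n)) * Bernstein n k ?x\<bar> \<le> e/4 * Bernstein n k ?x"
        using mult_right_mono[OF _ B[of k]] unfolding abs_mult abs_of_nonneg[OF B] by blast
    qed
    also have "\<dots> = e/4"
      by (simp only: sum_distrib_left[symmetric] sum_Bernstein mult_1_right)
    finally have 1: "\<bar>(\<Sum>k\<le>n. of_rat (qs ! k) * Bernstein n k ?x) -
      (\<Sum>k\<le>n. g (k/n) * Bernstein n k ?x)\<bar> \<le> e/4" .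
    have 2: "g ?x = apply_bcontfun f s"
      by (simp add: g_def of_unit_inverse)
    show ?thesis
      using 1 n[OF x] unfolding dist_real_def rational_Bernstein_apply len 2[symmetric] by linarith
  qed
  then have "dist (rational_Bernstein qs) f \<le> e/2"
    by (rule dist_bound)
  then show ?thesis
    using assms by (intro exI[of _ qs]) simp
qed

lemma (in continuous_process) measurable_sample_path:
  "sample_path X \<in> M \<rightarrow>\<^sub>M borel"
proof (rule borel_measurableI)
  fix U :: "(unit_interval \<Rightarrow>\<^sub>C real) set"
  assume U: "open U"
  let ?I = "{(qs, r). r \<in> \<rat> \<and> cball (rational_Bernstein qs) r \<subseteq> U}"
  have U_eq: "U = (\<Union>(qs, r)\<in>?I. cball (rational_Bernstein qs) r)"
  proof (intro equalityI subsetI)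
    fix f assume "f \<in> U"
    with U obtain e where e: "e > 0" "ball f e \<subseteq> U"
      by (meson openE)
    obtain qs where qs: "dist (rational_Bernstein qs) f < e/4"
      using rational_Bernstein_dense[of "e/4" f] e(1) by auto
    obtain r where r: "r \<in> \<rat>" "e/4 < r" "r < e/2"
      using Rats_dense_in_real[of "e/4" "e/2"] e(1) by auto
    have "cball (rational_Bernstein qs) r \<subseteq> ball f e"
    proof
      fix g assume "g \<in> cball (rational_Bernstein qs) r"
      then have "dist (rational_Bernstein qs) g \<le> r" by simp
      moreover have "dist f g \<le> dist (rational_Bernstein qs) f + dist (rational_Bernstein qs) g"
        by (rule dist_triangle3)
      ultimately show "g \<in> ball f e" using qs r e by simp
    qed
    with e r qs show "f \<in> (\<Union>(qs, r)\<in>?I. cball (rational_Bernstein qs) r)"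
      by (intro UN_I[of "(qs, r)"]) auto
  qed auto
  have "?I \<subseteq> UNIV \<times> \<rat>" by auto
  moreover have "countable (UNIV \<times> \<rat> :: (rat list \<times> real) set)"
    by (intro countable_SIGMA countable_rat) auto
  ultimately have I: "countable ?I" by (rule countable_subset)
  have ball: "sample_path X -` cball h r \<inter> space M \<in> sets M" for h :: "unit_interval \<Rightarrow>\<^sub>C real" and r
  proof -
    have *: "dist h (sample_path X \<omega>) \<le> r \<longleftrightarrow>
      (\<forall>q\<in>\<rat> \<inter> {0..1}. \<bar>apply_bcontfun h (to_unit q) - X q \<omega>\<bar> \<le> r)" if "\<omega> \<in> space M" for \<omega>
    proof
      assume L: "dist h (sample_path X \<omega>) \<le> r"
      show "\<forall>q\<in>\<rat> \<inter> {0..1}. \<bar>apply_bcontfun h (to_unit q) - X q \<omega>\<bar> \<le> r"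
      proof
        fix q :: real assume q: "q \<in> \<rat> \<inter> {0..1}"
        have "dist (apply_bcontfun h (to_unit q)) (apply_bcontfun (sample_path X \<omega>) (to_unit q)) \<le> r"
          using dist_bounded L order_trans by blast
        then show "\<bar>apply_bcontfun h (to_unit q) - X q \<omega>\<bar> \<le> r"
          using q by (simp add: sample_path_apply continuous_paths that to_unit_inverse dist_real_def)
      qed
    next
      assume R: "\<forall>q\<in>\<rat> \<inter> {0..1}. \<bar>apply_bcontfun h (to_unit q) - X q \<omega>\<bar> \<le> r"
      have ts: "continuous_on {0..1} to_unit"
        by (auto simp: continuous_on_iff dist_unit_interval_def to_unit_inverse)
      have cont: "continuous_on {0..1} (\<lambda>x. \<bar>apply_bcontfun h (to_unit x) - X x \<omega>\<bar>)"
        by (intro continuous_intros continuous_paths that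
            continuous_on_compose2[OF continuous_on_apply_bcontfun[of UNIV h] ts]) auto
      have dense: "{0..1} \<subseteq> closure (\<rat> \<inter> {0..1::real})"
      proof -
        have "{0<..<1} \<inter> closure \<rat> \<subseteq> closure ({0<..<1} \<inter> (\<rat>::real set))"
          by (rule open_Int_closure_subset) simp
        then have "{0<..<1} \<subseteq> closure ({0<..<1} \<inter> (\<rat>::real set))"
          by (simp add: Rats_closure_real)
        then have "closure {0<..<1::real} \<subseteq> closure ({0<..<1} \<inter> (\<rat>::real set))"
          by (rule closure_minimal) (rule closed_closure)
        also have "\<dots> \<subseteq> closure (\<rat> \<inter> {0..1})"
          by (intro closure_mono) auto
        finally show ?thesis by (simp add: closure_greaterThanLessThan)
      qed
      have cl: "closure (\<rat> \<inter> {0..1::real}) = {0..1}"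
        using dense by (intro equalityI closure_minimal) auto
      have *: "\<bar>apply_bcontfun h (to_unit x) - X x \<omega>\<bar> \<le> r" if "x \<in> {0..1}" for x
        using continuous_le_on_closure[of "\<rat> \<inter> {0..1}" "\<lambda>x. \<bar>apply_bcontfun h (to_unit x) - X x \<omega>\<bar>" x r]
          cont R that by (simp add: cl)
      show "dist h (sample_path X \<omega>) \<le> r"
      proof (rule dist_bound)
        fix s show "dist (apply_bcontfun h s) (apply_bcontfun (sample_path X \<omega>) s) \<le> r"
          using *[OF of_unit_mem[of s]]
          by (simp add: sample_path_apply continuous_paths \<open>\<omega> \<in> space M\<close> dist_real_def of_unit_inverse)
      qed
    qed
    have "sample_path X -` cball h r \<inter> space M =
      {\<omega> \<in> space M. \<forall>q\<in>\<rat> \<inter> {0..1}. \<bar>apply_bcontfun h (to_unit q) - X q \<omega>\<bar> \<le> r}"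
      using * by auto
    also have "\<dots> \<in> sets M"
    proof (rule sets.sets_Collect_countable_All')
      show "countable (\<rat> \<inter> {0..1::real})" by (simp add: countable_rat countable_Int1)
      fix q :: real assume "q \<in> \<rat> \<inter> {0..1}"
      then have [measurable]: "X q \<in> borel_measurable M" by (intro measurable_process) auto
      show "{\<omega> \<in> space M. \<bar>apply_bcontfun h (to_unit q) - X q \<omega>\<bar> \<le> r} \<in> sets M"
        by measurable
    qed
    finally show ?thesis .
  qed
  have "sample_path X -` U \<inter> space M =
    (\<Union>(qs, r)\<in>?I. sample_path X -` cball (rational_Bernstein qs) r \<inter> space M)"
    by (subst U_eq) auto
  also have "\<dots> \<in> sets M"
    using ball by (intro sets.countable_UN'' I) (auto split: prod.splits)
  finally show "sample_path X -` U \<inter> space M \<in> sets M" .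
qed

locale standard_brownian_motion = continuous_process +
  assumes starts_at_zero: "AE \<omega> in M. X 0 \<omega> = 0"
    and gaussian_increments: "\<And>s t. 0 \<le> s \<Longrightarrow> s < t \<Longrightarrow> t \<le> 1 \<Longrightarrow>
      distributed M lborel (\<lambda>\<omega>. X t \<omega> - X s \<omega>) (normal_density 0 (sqrt (t - s)))"
    and independent_increments: "\<And>(t :: nat \<Rightarrow> real) n.
      0 \<le> t 0 \<Longrightarrow> (\<And>i. i < n \<Longrightarrow> t i < t (Suc i)) \<Longrightarrow> t n \<le> 1 \<Longrightarrow>
      indep_vars (\<lambda>_. borel) (\<lambda>i \<omega>. X (t (Suc i)) \<omega> - X (t i) \<omega>) {..<n}"

definition converges_weakly ::
    "('i \<Rightarrow> 'b::topological_space measure) \<Rightarrow> 'b measure \<Rightarrow> 'i filter \<Rightarrow> bool"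
  where "converges_weakly \<mu> \<nu> F \<longleftrightarrow>
    (\<forall>f :: 'b \<Rightarrow> real. continuous_on UNIV f \<and> bounded (range f) \<longrightarrow>
      ((\<lambda>i. \<integral>x. f x \<partial>\<mu> i) \<longlongrightarrow> (\<integral>x. f x \<partial>\<nu>)) F)"

text \<open>\<^term>\<open>uniform_measure P A\<close> is the conditional probability \<open>P(\<sqdot> | A)\<close>.\<close>

definition brownian_ascent ::
    "'p measure \<Rightarrow> (real \<Rightarrow> 'p \<Rightarrow> real) \<Rightarrow> 'n measure \<Rightarrow> (real \<Rightarrow> 'n \<Rightarrow> real) \<Rightarrow> bool"
  where "brownian_ascent P X N a \<longleftrightarrow>
    standard_brownian_motion P X \<and>
    continuous_process N a \<and>
    converges_weakly
      (\<lambda>\<epsilon>. path_law (uniform_measure P {\<omega> \<in> space P. (SUP s\<in>{0..1}. X s \<omega>) - X 1 \<omega> < \<epsilon>}) X)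
      (path_law N a)
      (at_right 0)"

end

theory Submission
  imports Defs
begin

text \<open>
  Fix a grid time \<open>t = k/n\<close>. The path before \<open>t\<close>, rescaled to \<open>[0,1]\<close>, is again a Brownian motion
  and is independent of the increments after \<open>t\<close>. The argmax \<open>\<Theta>\<close> lies in \<open>(k/n, (k+1)/n]\<close> iff the
  drawdown \<open>max\<^bsub>[0,t]\<^esub> W - W\<^sub>t\<close> is below the threshold \<open>max\<^bsub>[t,1]\<^esub> W - W\<^sub>t\<close> and that threshold is
  attained in \<open>[t, (k+1)/n]\<close>. Both the threshold and the second event depend only on the future,
  so given the future and this event the rescaled past is a Brownian motion conditioned on having
  final drawdown below the threshold divided by \<open>\<surd>t\<close>. Summing over \<open>k\<close> and letting \<open>n \<rightarrow> \<infinity>\<close>, the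
  threshold tends to 0 and \<open>k/n\<close> tends to \<open>\<Theta>\<close>, so the conditional laws converge to that of
  the ascent on one side and to that of the path up to \<open>\<Theta>\<close>, rescaled, on the other.
\<close>

section \<open>Path space\<close>

text \<open>No explicit law of the ascent is used: \<open>brownian_ascent\<close> gives only the
  limit of conditional means of a bounded continuous functional as the drawdown bound decreases to
  0, and the proof is arranged to consume exactly this limit. Conditioning on the value of \<Theta>
  would mean conditioning on null events, hence the grid. On a cell the drawdown bound is random,
  but it is a function of the future alone, so independence allows it to be frozen. Brownian scaling
  gives the rescaled past the law of X itself, so one deterministic function
  \<open>small_drawdown_mean\<close> serves every grid time. On the cell that contains \<Theta>, the
  maximum over [t,1] is the global maximum, so the bound becomes a continuous function of t that
  vanishes at \<Theta>. Two almost sure facts carry the limit: uniqueness of the maximiser makes the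
  cells exact and keeps the bound strictly positive before \<Theta>, as the one-sided limit
  requires; and \<Theta> > 0 keeps the times away from the singular scaling at 0.\<close>

lemma measure_eqI_bounded_continuous:
  fixes \<mu> \<nu> :: "'b::metric_space measure"
  assumes "finite_measure \<mu>" "finite_measure \<nu>"
    and sets: "sets \<mu> = sets borel" "sets \<nu> = sets borel"
    and eq: "\<And>f :: 'b \<Rightarrow> real. continuous_on UNIV f \<Longrightarrow> bounded (range f) \<Longrightarrow>
      integral\<^sup>L \<mu> f = integral\<^sup>L \<nu> f"
  shows "\<mu> = \<nu>"
proof (rule measure_eqI_generator_eq[where E="Collect closed" and \<Omega>=UNIV and A="\<lambda>_. UNIV"])
  interpret \<mu>: finite_measure \<mu> by fact
  interpret \<nu>: finite_measure \<nu> by fact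
  show "Int_stable (Collect closed :: 'b set set)"
    by (auto simp: Int_stable_def)
  show "sets \<mu> = sigma_sets UNIV (Collect closed)" "sets \<nu> = sigma_sets UNIV (Collect closed)"
    using sets by (simp_all add: borel_eq_closed)
  show "emeasure \<mu> UNIV \<noteq> \<infinity>" by simp
  fix C :: "'b set" assume "C \<in> Collect closed"
  then have C: "closed C" by simp
  show "emeasure \<mu> C = emeasure \<nu> C"
  \<comment> \<open>The empty set is split off because \<open>infdist x {}\<close> is 0 by
    convention, so the functions below would be constantly 1 instead of approximating its
    indicator.\<close>
  proof (cases "C = {}")
    case False
    \<comment> \<open>Continuous functions with values in [0,1], equal to 1 on \<open>C\<close> and
      eventually 0 at each point off the closed set \<open>C\<close>; dominated convergence recovers
      the measure of \<open>C\<close>.\<close>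
    define f where "f n x = max 0 (1 - real n * infdist x C)" for n x
    have cont: "continuous_on UNIV (f n)" for n
      unfolding f_def by (intro continuous_intros)
    have bound: "norm (f n x) \<le> 1" for n x
      by (auto simp: f_def infdist_nonneg)
    have lim: "(\<lambda>n. f n x) \<longlonglongrightarrow> indicator C x" for x
    proof (cases "x \<in> C")
      case True
      then show ?thesis by (simp add: f_def)
    next
      case x: False
      have d: "infdist x C > 0"
        using infdist_pos_not_in_closed[OF C False x] .
      obtain N where N: "1 / infdist x C < real N"
        using reals_Archimedean2 by blast
      have "f n x = 0" if "n \<ge> N" for n
      proof -
        have "1 < real N * infdist x C"
          using N d by (simp add: field_simps)
        also have "\<dots> \<le> real n * infdist x C"
          using that d by (intro mult_right_mono) auto
        finally show ?thesis by (simp add: f_def)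
      qed
      then have "\<forall>\<^sub>F n in sequentially. f n x = indicator C x"
        using x by (auto simp: eventually_sequentially)
      then show ?thesis by (rule tendsto_eventually)
    qed
    have *: "(\<lambda>n. integral\<^sup>L \<kappa> (f n)) \<longlonglongrightarrow> measure \<kappa> C"
      if "finite_measure \<kappa>" "sets \<kappa> = sets borel" for \<kappa> :: "'b measure"
    proof -
      interpret \<kappa>: finite_measure \<kappa> by fact
      have "(\<lambda>n. integral\<^sup>L \<kappa> (f n)) \<longlonglongrightarrow> integral\<^sup>L \<kappa> (indicator C)"
      proof (rule integral_dominated_convergence[where w="\<lambda>_. 1"])
        show "f n \<in> borel_measurable \<kappa>" for n
          using borel_measurable_continuous_onI[OF cont[of n]] that(2)
          by (simp cong: measurable_cong_sets)
        show "(indicator C :: 'b \<Rightarrow> real) \<in> borel_measurable \<kappa>"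
          using C that(2) by (simp cong: measurable_cong_sets)
      qed (use lim bound in auto)
      then show ?thesis
        using C that(2) by (simp add: sets_eq_imp_space_eq[OF that(2)])
    qed
    have "integral\<^sup>L \<mu> (f n) = integral\<^sup>L \<nu> (f n)" for n
      by (intro eq cont boundedI[where B=1]) (use bound in auto)
    with *[OF \<open>finite_measure \<mu>\<close> sets(1)] *[OF \<open>finite_measure \<nu>\<close> sets(2)]
    have "measure \<mu> C = measure \<nu> C"
      by (auto intro: LIMSEQ_unique)
    then show ?thesis
      by (simp add: \<mu>.emeasure_eq_measure \<nu>.emeasure_eq_measure)
  qed simp
qed auto

lemma to_unit_of_unit [simp]: "to_unit (of_unit s) = s"
  by (rule of_unit_inverse)

lemma of_unit_to_unit [simp]: "s \<in> {0..1} \<Longrightarrow> of_unit (to_unit s) = s"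
  by (rule to_unit_inverse)

lemma continuous_on_to_unit: "continuous_on {0..1} to_unit"
  by (auto simp: continuous_on_iff dist_unit_interval_def)

lemma continuous_on_path:
  "continuous_on {0..1} (\<lambda>s. apply_bcontfun (f :: unit_interval \<Rightarrow>\<^sub>C real) (to_unit s))"
  by (rule continuous_on_compose2[OF continuous_on_apply_bcontfun[of UNIV f] continuous_on_to_unit])
    auto

lemma measurable_coordinate [measurable]:
  "(\<lambda>f :: unit_interval \<Rightarrow>\<^sub>C real. apply_bcontfun f s) \<in> borel_measurable borel"
proof (rule borel_measurable_continuous_onI)
  show "continuous_on UNIV (\<lambda>f :: unit_interval \<Rightarrow>\<^sub>C real. apply_bcontfun f s)"
    unfolding continuous_on_iff using dist_bounded le_less_trans by blast
qed

text \<open>The \<pi>-system of finite-dimensional events. Laws and independence are checked here,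
  since Brownian motion is specified only through finitely many increments.\<close>

definition cylinders :: "(unit_interval \<Rightarrow>\<^sub>C real) set set"
  where "cylinders = {A. \<exists>J B. finite J \<and> (\<forall>s. B s \<in> sets borel) \<and>
    A = {f. \<forall>s\<in>J. apply_bcontfun f s \<in> B s}}"

lemma Int_stable_cylinders: "Int_stable cylinders"
proof (rule Int_stableI)
  fix A A' assume "A \<in> cylinders" "A' \<in> cylinders"
  then obtain J B J' B' where
    "finite J" "\<forall>s. B s \<in> sets borel" "A = {f. \<forall>s\<in>J. apply_bcontfun f s \<in> B s}"
    "finite J'" "\<forall>s. B' s \<in> sets borel" "A' = {f. \<forall>s\<in>J'. apply_bcontfun f s \<in> B' s}"
    unfolding cylinders_def by auto
  then show "A \<inter> A' \<in> cylinders"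
    unfolding cylinders_def
    by (intro CollectI exI[of _ "J \<union> J'"]
        exI[of _ "\<lambda>s. (if s \<in> J then B s else UNIV) \<inter> (if s \<in> J' then B' s else UNIV)"]) auto
qed

lemma sets_borel_paths: "sets borel = sigma_sets UNIV cylinders"
proof
  show "sigma_sets UNIV cylinders \<subseteq> sets borel"
  proof (rule sets.sigma_sets_subset'[where M=borel, simplified])
    show "cylinders \<subseteq> sets borel"
    proof
      fix A assume "A \<in> cylinders"
      then obtain J B where *: "finite J" "\<forall>s. B s \<in> sets borel"
        "A = {f. \<forall>s\<in>J. apply_bcontfun f s \<in> B s}"
        unfolding cylinders_def by auto
      have "{f \<in> space borel. \<forall>s\<in>J. apply_bcontfun f s \<in> B s} \<in> sets borel"
      proof (rule sets.sets_Collect_finite_All[OF _ *(1)])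
        fix s
        have [measurable]: "B s \<in> sets borel" using * by auto
        show "{f \<in> space borel. apply_bcontfun f s \<in> B s} \<in> sets borel"
          by measurable
      qed
      then show "A \<in> sets borel" using *(3) by simp
    qed
  qed auto
  \<comment> \<open>The sample path of the coordinate process on the cylinder \<open>\<sigma>\<close>-algebra is the identity, so
    its measurability is the missing inclusion; the measure is irrelevant.\<close>
  let ?C = "sigma UNIV cylinders"
  interpret continuous_process "return ?C 0"
    "\<lambda>s f. apply_bcontfun f (to_unit s)"
  proof (intro continuous_process.intro prob_space_return continuous_process_axioms.intro
      continuous_on_path)
    fix s :: real
    show "(\<lambda>f. apply_bcontfun f (to_unit s)) \<in> borel_measurable (return ?C 0)"
    proof (rule measurableI)
      fix A :: "real set" assume "A \<in> sets borel"
      then have "{f. \<forall>s\<in>{to_unit s}. apply_bcontfun f s \<in> A} \<in> cylinders"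
        unfolding cylinders_def by (intro CollectI exI[of _ "{to_unit s}"] exI[of _ "\<lambda>_. A"]) auto
      then show "(\<lambda>f. apply_bcontfun f (to_unit s)) -` A \<inter> space (return ?C 0)
          \<in> sets (return ?C 0)"
        by (auto simp: vimage_def)
    qed auto
  qed auto
  have "sample_path (\<lambda>s f. apply_bcontfun f (to_unit s)) = (\<lambda>f. f)"
    by (intro ext) (simp add: sample_path_def apply_bcontfun_inverse)
  then have "(\<lambda>f. f) \<in> ?C \<rightarrow>\<^sub>M borel"
    using measurable_sample_path by (simp add: measurable_cong_sets[OF sets_return])
  then show "sets borel \<subseteq> sigma_sets UNIV cylinders"
    by (auto simp: measurable_def)
qed

definition path_sup :: "real set \<Rightarrow> (unit_interval \<Rightarrow>\<^sub>C real) \<Rightarrow> real"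
  where "path_sup K f = (SUP s\<in>K. apply_bcontfun f (to_unit s))"

lemma path_sup_upper:
  assumes "s \<in> K"
  shows "apply_bcontfun f (to_unit s) \<le> path_sup K f"
  unfolding path_sup_def
proof (rule cSUP_upper[OF assms])
  have "bounded (range (apply_bcontfun f))"
    by simp
  then have "bounded ((\<lambda>s. apply_bcontfun f (to_unit s)) ` K)"
    by (rule bounded_subset) auto
  then show "bdd_above ((\<lambda>s. apply_bcontfun f (to_unit s)) ` K)"
    by (rule bounded_imp_bdd_above)
qed

lemma path_sup_least:
  "K \<noteq> {} \<Longrightarrow> (\<And>s. s \<in> K \<Longrightarrow> apply_bcontfun f (to_unit s) \<le> x) \<Longrightarrow> path_sup K f \<le> x"
  unfolding path_sup_def by (rule cSUP_least)

lemma path_sup_eqI: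
  "s \<in> K \<Longrightarrow> (\<And>u. u \<in> K \<Longrightarrow> apply_bcontfun f (to_unit u) \<le> apply_bcontfun f (to_unit s)) \<Longrightarrow>
    path_sup K f = apply_bcontfun f (to_unit s)"
  by (intro antisym path_sup_least path_sup_upper) auto

text \<open>For nonempty \<open>K\<close> the supremum is 1-Lipschitz in the uniform distance, hence
  continuous. This holds for any set \<open>K\<close> of reals: outside [0,1] \<open>to_unit\<close>
  is unspecified, but the values stay in the range of a bounded function.\<close>

lemma measurable_path_sup [measurable]: "path_sup K \<in> borel_measurable borel"
proof (cases "K = {}")
  case True
  then show ?thesis by (simp add: path_sup_def[abs_def])
next
  case False
  have le: "path_sup K f \<le> path_sup K g + dist f g" for f g
  proof (rule path_sup_least[OF False])
    fix s assume "s \<in> K"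
    then show "apply_bcontfun f (to_unit s) \<le> path_sup K g + dist f g"
      using path_sup_upper[of s K g] dist_bounded[of f "to_unit s" g]
      by (auto simp: dist_real_def)
  qed
  have "dist (path_sup K f) (path_sup K g) \<le> dist f g" for f g
    using le[of f g] le[of g f] by (auto simp: dist_real_def dist_commute abs_le_iff)
  then have "continuous_on UNIV (path_sup K)"
    unfolding continuous_on_iff using le_less_trans by blast
  then show ?thesis by (rule borel_measurable_continuous_onI)
qed

text \<open>Independence of increments is stated along strictly increasing times, so an arbitrary
  finite set of times is first embedded in a partition that contains both endpoints.\<close>

lemma finite_subset_grid:
  fixes a b :: real
  assumes "finite J" "J \<subseteq> {a..b}" "a < b"
  obtains t :: "nat \<Rightarrow> real" and n where "t 0 = a" "t n = b" "\<And>i. i < n \<Longrightarrow> t i < t (Suc i)"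
    "J \<subseteq> t ` {..n}"
proof -
  define l where "l = sorted_list_of_set (insert a (insert b J))"
  have set: "set l = insert a (insert b J)" and l: "sorted_wrt (<) l"
    using assms(1) set_sorted_list_of_set[of "insert a (insert b J)"]
      strict_sorted_list_of_set[of "insert a (insert b J)"] unfolding l_def by blast+
  have ne: "l \<noteq> []" using set by auto
  define n where "n = length l - 1"
  have len: "length l = Suc n" using ne by (cases l) (auto simp: n_def)
  have range: "l ! i \<in> {a..b}" if "i \<le> n" for i
  proof -
    have "l ! i \<in> set l" using that len by simp
    then show ?thesis using set assms by auto
  qed
  have less: "l ! i < l ! j" if "i < j" "j \<le> n" for i j
    using sorted_wrt_nth_less[OF l that(1)] that(2) len by simp
  obtain i where i: "i \<le> n" "l ! i = a"
    using set len by (metis in_set_conv_nth insertI1 less_Suc_eq_le)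
  obtain j where j: "j \<le> n" "l ! j = b"
    using set len by (metis in_set_conv_nth insertI1 insert_commute less_Suc_eq_le)
  show ?thesis
  proof (rule that[of "\<lambda>i. l ! i" n])
    show "l ! 0 = a"
      using i less[of 0 i] range[of 0] by (cases "i = 0") auto
    show "l ! n = b"
      using j less[of j n] range[of n] by (cases "j = n") auto
    show "J \<subseteq> (\<lambda>i. l ! i) ` {..n}"
    proof
      fix x assume "x \<in> J"
      then have "x \<in> set l" using set by simp
      then show "x \<in> (\<lambda>i. l ! i) ` {..n}"
        using len by (auto simp: in_set_conv_nth less_Suc_eq_le)
    qed
  qed (use less in auto)
qed

section \<open>The law of Brownian motion and its past and future at a fixed time\<close>

lemma sets_cylinder_increments:
  assumes "finite I" "\<And>j. j \<in> I \<Longrightarrow> L j \<subseteq> K" "\<And>j. j \<in> I \<Longrightarrow> B j \<in> sets (borel :: real measure)"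
  shows "{v \<in> space (PiM K (\<lambda>_. borel)). \<forall>j\<in>I. (\<Sum>k\<in>L j. v k) \<in> B j} \<in> sets (PiM K (\<lambda>_. borel))"
proof (rule sets.sets_Collect_finite_All[OF _ assms(1)])
  fix j assume "j \<in> I"
  with assms have [measurable]: "B j \<in> sets borel" and L: "L j \<subseteq> K" by auto
  have [measurable]: "(\<lambda>v. \<Sum>k\<in>L j. v k :: real) \<in> borel_measurable (PiM K (\<lambda>_. borel))"
    using L by (intro borel_measurable_sum measurable_component_singleton) auto
  show "{v \<in> space (PiM K (\<lambda>_. borel)). (\<Sum>k\<in>L j. v k) \<in> B j} \<in> sets (PiM K (\<lambda>_. borel))"
    by measurable
qed

lemma grid_mono:
  fixes t :: "nat \<Rightarrow> real"
  assumes "\<And>i. i < n \<Longrightarrow> t i < t (Suc i)" "k \<le> l" "l \<le> n"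
  shows "t k \<le> t l"
  using assms(2,3)
proof (induction l rule: dec_induct)
  case (step l)
  then have "t k \<le> t l" by simp
  also have "t l \<le> t (Suc l)" using assms(1) step by (simp add: less_imp_le)
  finally show ?case .
qed simp

context standard_brownian_motion
begin

text \<open>Almost surely each grid value is a partial sum of independent Gaussian increments. The
  right side mentions the grid only, neither \<open>M\<close> nor \<open>X\<close>, and so is common
  to all Brownian motions.\<close>

lemma prob_cylinder_grid:
  assumes grid: "t 0 = 0" "\<And>i. i < n \<Longrightarrow> t i < t (Suc i)" "t n \<le> 1" and "0 < n"
    and I: "finite I" "\<And>j. j \<in> I \<Longrightarrow> i j \<le> n" "\<And>j. j \<in> I \<Longrightarrow> B j \<in> sets borel"
  shows "prob {\<omega> \<in> space M. \<forall>j\<in>I. X (t (i j)) \<omega> \<in> B j} =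
    measure (PiM {..<n} (\<lambda>k. density lborel (normal_density 0 (sqrt (t (Suc k) - t k)))))
      {v \<in> space (PiM {..<n} (\<lambda>_. borel)). \<forall>j\<in>I. (\<Sum>k<i j. v k) \<in> B j}"
proof -
  have mono: "t k \<le> t l" if "k \<le> l" "l \<le> n" for k l
    using grid_mono[of n t] grid(2) that by blast
  have range: "t k \<in> {0..1}" if "k \<le> n" for k
    using mono[of 0 k] mono[of k n] grid that by auto
  define D where "D k \<omega> = X (t (Suc k)) \<omega> - X (t k) \<omega>" for k \<omega>
  have indep: "indep_vars (\<lambda>_. borel) D {..<n}"
    unfolding D_def[abs_def] using grid by (intro independent_increments) auto
  have D [measurable]: "D k \<in> borel_measurable M" if "k \<in> {..<n}" for k
    using that range unfolding D_def[abs_def] by (intro borel_measurable_diff measurable_process) auto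
  have law: "distr M borel (D k) = density lborel (normal_density 0 (sqrt (t (Suc k) - t k)))"
    if "k < n" for k
  proof -
    have "distr M borel (D k) = distr M lborel (D k)"
      by (intro distr_cong) auto
    also have "\<dots> = density lborel (normal_density 0 (sqrt (t (Suc k) - t k)))"
      unfolding D_def[abs_def] using that range[of k] range[of "Suc k"] grid(2)[of k]
      by (intro distributed_distr_eq_density[OF gaussian_increments]) auto
    finally show ?thesis .
  qed
  let ?D = "\<lambda>\<omega>. \<lambda>k\<in>{..<n}. D k \<omega>" and ?P = "PiM {..<n} (\<lambda>_. borel :: real measure)"
  let ?A = "{v \<in> space ?P. \<forall>j\<in>I. (\<Sum>k<i j. v k) \<in> B j}"
  have "distr M ?P ?D = PiM {..<n} (\<lambda>k. distr M borel (D k))"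
    using indep_vars_iff_distr_eq_PiM'[THEN iffD1, OF _ D indep] \<open>0 < n\<close> by auto
  also have "\<dots> = PiM {..<n} (\<lambda>k. density lborel (normal_density 0 (sqrt (t (Suc k) - t k))))"
    by (intro PiM_cong) (auto simp: law)
  finally have *: "distr M ?P ?D = \<dots>" .
  have A: "?A \<in> sets ?P"
    using I by (intro sets_cylinder_increments) fastforce+
  have "AE \<omega> in M. (\<omega> \<in> {\<omega> \<in> space M. \<forall>j\<in>I. X (t (i j)) \<omega> \<in> B j}) = (\<omega> \<in> ?D -` ?A \<inter> space M)"
    using starts_at_zero
  proof eventually_elim
    case (elim \<omega>)
    have "(\<Sum>k<i j. ?D \<omega> k) = X (t (i j)) \<omega>" if "j \<in> I" for j
    proof -
      have "(\<Sum>k<i j. ?D \<omega> k) = (\<Sum>k<i j. X (t (Suc k)) \<omega> - X (t k) \<omega>)"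
        using I(2)[OF that] by (intro sum.cong) (auto simp: D_def)
      then show ?thesis
        using elim grid(1) by (simp add: sum_lessThan_telescope[of "\<lambda>k. X (t k) \<omega>"])
    qed
    then show ?case by (auto simp: space_PiM)
  qed
  moreover have "{\<omega> \<in> space M. \<forall>j\<in>I. X (t (i j)) \<omega> \<in> B j} \<in> events"
  proof (rule sets.sets_Collect_finite_All[OF _ I(1)])
    fix j assume "j \<in> I"
    then have [measurable]: "B j \<in> sets borel" "X (t (i j)) \<in> borel_measurable M"
      using I range by (auto intro: measurable_process)
    show "{\<omega> \<in> space M. X (t (i j)) \<omega> \<in> B j} \<in> events" by measurable
  qed
  moreover have m: "?D \<in> M \<rightarrow>\<^sub>M ?P"
    by (intro measurable_restrict D)
  ultimately have "prob {\<omega> \<in> space M. \<forall>j\<in>I. X (t (i j)) \<omega> \<in> B j} = prob (?D -` ?A \<inter> space M)"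
    by (intro measure_eq_AE measurable_sets[OF m A])
  also have "\<dots> = measure (distr M ?P ?D) ?A"
    using m A by (simp add: measure_distr)
  finally show ?thesis unfolding * .
qed

text \<open>A partition of [0,t] and one of [t,1] are joined into a single one. The past event then
  depends on the first \<open>m\<close> increments and the future event on the other
  \<open>l\<close>, and disjoint blocks of independent variables are independent.\<close>

lemma prob_past_future_cylinders:
  assumes t: "0 < t" "t < 1"
    and I: "finite I" "\<And>j. j \<in> I \<Longrightarrow> \<tau> j \<in> {0..t}" "\<And>j. j \<in> I \<Longrightarrow> B j \<in> sets borel"
    and K: "finite K" "\<And>j. j \<in> K \<Longrightarrow> \<sigma> j \<in> {t..1}" "\<And>j. j \<in> K \<Longrightarrow> C j \<in> sets borel"
  shows "prob ({\<omega> \<in> space M. \<forall>j\<in>I. X (\<tau> j) \<omega> \<in> B j} \<inter>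
      {\<omega> \<in> space M. \<forall>j\<in>K. X (\<sigma> j) \<omega> - X t \<omega> \<in> C j}) =
    prob {\<omega> \<in> space M. \<forall>j\<in>I. X (\<tau> j) \<omega> \<in> B j} *
    prob {\<omega> \<in> space M. \<forall>j\<in>K. X (\<sigma> j) \<omega> - X t \<omega> \<in> C j}" (is "prob (?F \<inter> ?G) = _")
proof -
  obtain a m where a: "a 0 = 0" "a m = t" "\<And>k. k < m \<Longrightarrow> a k < a (Suc k)" "\<tau> ` I \<subseteq> a ` {..m}"
    using finite_subset_grid[of "\<tau> ` I" 0 t] I t by (metis finite_imageI image_subset_iff)
  obtain b l where b: "b 0 = t" "b l = 1" "\<And>k. k < l \<Longrightarrow> b k < b (Suc k)" "\<sigma> ` K \<subseteq> b ` {..l}"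
    using finite_subset_grid[of "\<sigma> ` K" t 1] K t by (metis finite_imageI image_subset_iff)
  have "\<forall>j\<in>I. \<exists>k\<le>m. \<tau> j = a k" using a(4) by auto
  then obtain p where p: "\<And>j. j \<in> I \<Longrightarrow> p j \<le> m" "\<And>j. j \<in> I \<Longrightarrow> \<tau> j = a (p j)"
    by metis
  have "\<forall>j\<in>K. \<exists>k\<le>l. \<sigma> j = b k" using b(4) by auto
  then obtain q where q: "\<And>j. j \<in> K \<Longrightarrow> q j \<le> l" "\<And>j. j \<in> K \<Longrightarrow> \<sigma> j = b (q j)"
    by metis
  \<comment> \<open>The two partitions agree at the junction, \<open>a m = t = b 0\<close>, so
    \<open>c (m + k) = b k\<close> holds at \<open>k = 0\<close> too.\<close>
  define c where "c k = (if k \<le> m then a k else b (k - m))" for k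
  have c_a: "c k = a k" if "k \<le> m" for k using that by (simp add: c_def)
  have c_b: "c (m + k) = b k" for k using a b by (auto simp: c_def)
  have c_less: "c k < c (Suc k)" if "k < m + l" for k
  proof (cases "k < m")
    case True
    then show ?thesis using a(3)[of k] by (simp add: c_a)
  next
    case False
    then obtain k' where "k = m + k'" by (metis le_Suc_ex not_less)
    then show ?thesis using b(3)[of k'] that c_b[of k'] c_b[of "Suc k'"] by simp
  qed
  define D where "D k \<omega> = X (c (Suc k)) \<omega> - X (c k) \<omega>" for k \<omega>
  have "indep_vars (\<lambda>_. borel) D {..<m + l}"
    unfolding D_def[abs_def] using c_a[of 0] c_b[of l] a b c_less
    by (intro independent_increments) auto
  then have indep: "indep_var (PiM {..<m} (\<lambda>_. borel)) (\<lambda>\<omega>. restrict (\<lambda>k. D k \<omega>) {..<m})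
      (PiM {m..<m+l} (\<lambda>_. borel)) (\<lambda>\<omega>. restrict (\<lambda>k. D k \<omega>) {m..<m+l})"
    (is "indep_var ?P ?D ?Q ?E")
    by (rule indep_var_restrict) auto
  let ?A = "{v \<in> space ?P. \<forall>j\<in>I. (\<Sum>k<p j. v k) \<in> B j}"
    and ?B = "{v \<in> space ?Q. \<forall>j\<in>K. (\<Sum>k=m..<m + q j. v k) \<in> C j}"
  have A: "?A \<in> sets ?P"
    using I p by (intro sets_cylinder_increments) fastforce+
  have B: "?B \<in> sets ?Q"
    using K q by (intro sets_cylinder_increments) fastforce+
  have DE [measurable]: "?D \<in> M \<rightarrow>\<^sub>M ?P" "?E \<in> M \<rightarrow>\<^sub>M ?Q"
    using indep unfolding indep_var_eq by auto
  have F: "?F \<in> events"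
  proof (rule sets.sets_Collect_finite_All[OF _ I(1)])
    fix j assume "j \<in> I"
    then have [measurable]: "B j \<in> sets borel" "X (\<tau> j) \<in> borel_measurable M"
      using I(2)[of j] I(3) t by (auto intro: measurable_process)
    show "{\<omega> \<in> space M. X (\<tau> j) \<omega> \<in> B j} \<in> events" by measurable
  qed
  have G: "?G \<in> events"
  proof (rule sets.sets_Collect_finite_All[OF _ K(1)])
    fix j assume "j \<in> K"
    then have [measurable]: "C j \<in> sets borel" "X (\<sigma> j) \<in> borel_measurable M"
        "X t \<in> borel_measurable M"
      using K(2)[of j] K(3) t by (auto intro: measurable_process)
    show "{\<omega> \<in> space M. X (\<sigma> j) \<omega> - X t \<omega> \<in> C j} \<in> events" by measurable
  qed
  have F_eq: "AE \<omega> in M. (\<omega> \<in> ?F) = (\<omega> \<in> ?D -` ?A \<inter> space M)"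
    using starts_at_zero
  proof eventually_elim
    case (elim \<omega>)
    have "(\<Sum>k<p j. ?D \<omega> k) = X (\<tau> j) \<omega>" if "j \<in> I" for j
    proof -
      have "(\<Sum>k<p j. ?D \<omega> k) = (\<Sum>k<p j. X (a (Suc k)) \<omega> - X (a k) \<omega>)"
        using p(1)[OF that] by (intro sum.cong) (auto simp: D_def c_a)
      then show ?thesis
        using elim a(1) p(2)[OF that] by (simp add: sum_lessThan_telescope[of "\<lambda>k. X (a k) \<omega>"])
    qed
    then show ?case by (auto simp: space_PiM)
  qed
  \<comment> \<open>An identity of sets, unlike \<open>F_eq\<close>: future values are measured from
    \<open>X t\<close>, so the almost sure start at 0 does not enter.\<close>
  have G_eq: "?G = ?E -` ?B \<inter> space M"
  proof -
    have "(\<Sum>k=m..<m + q j. ?E \<omega> k) = X (\<sigma> j) \<omega> - X t \<omega>" if "j \<in> K" for j \<omega>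
    proof -
      have "(\<Sum>k=m..<m + q j. ?E \<omega> k) = (\<Sum>k=m..<m + q j. X (c (Suc k)) \<omega> - X (c k) \<omega>)"
        using q(1)[OF that] by (intro sum.cong) (auto simp: D_def)
      also have "\<dots> = X (c (m + q j)) \<omega> - X (c m) \<omega>"
        by (rule sum_Suc_diff') simp
      finally show ?thesis
        using c_b[of "q j"] c_b[of 0] b(1) q(2)[OF that] by simp
    qed
    then show ?thesis by (auto simp: space_PiM)
  qed
  have D_ev: "?D -` ?A \<inter> space M \<in> events" and E_ev: "?E -` ?B \<inter> space M \<in> events"
    using measurable_sets[OF DE(1) A] measurable_sets[OF DE(2) B] .
  have "prob (?F \<inter> ?G) = prob ((\<lambda>\<omega>. (?D \<omega>, ?E \<omega>)) -` (?A \<times> ?B) \<inter> space M)"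
  proof (rule measure_eq_AE)
    show "AE \<omega> in M. (\<omega> \<in> ?F \<inter> ?G) = (\<omega> \<in> (\<lambda>\<omega>. (?D \<omega>, ?E \<omega>)) -` (?A \<times> ?B) \<inter> space M)"
      using F_eq unfolding G_eq by eventually_elim blast
    have "(\<lambda>\<omega>. (?D \<omega>, ?E \<omega>)) -` (?A \<times> ?B) \<inter> space M =
      (?D -` ?A \<inter> space M) \<inter> (?E -` ?B \<inter> space M)" by blast
    then show "(\<lambda>\<omega>. (?D \<omega>, ?E \<omega>)) -` (?A \<times> ?B) \<inter> space M \<in> events"
      by (rule ssubst[where P="\<lambda>A. A \<in> events"]) (rule sets.Int[OF D_ev E_ev])
  qed (use F G in auto)
  also have "\<dots> = prob (?D -` ?A \<inter> space M) * prob (?E -` ?B \<inter> space M)"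
    by (rule indep_varD[OF indep A B])
  also have "prob (?D -` ?A \<inter> space M) = prob ?F"
    using F D_ev F_eq by (intro measure_eq_AE) auto
  finally show ?thesis unfolding G_eq .
qed

end

lemma (in continuous_process) path_law_cylinder:
  assumes "finite J" "\<And>s. B s \<in> sets borel"
  shows "measure (path_law M X) {f. \<forall>s\<in>J. apply_bcontfun f s \<in> B s} =
    prob {\<omega> \<in> space M. \<forall>s\<in>J. X (of_unit s) \<omega> \<in> B s}"
proof -
  have "{f. \<forall>s\<in>J. apply_bcontfun f s \<in> B s} \<in> cylinders"
    using assms by (auto simp: cylinders_def)
  then have "{f. \<forall>s\<in>J. apply_bcontfun f s \<in> B s} \<in> sets borel"
    by (auto simp: sets_borel_paths)
  then have "measure (path_law M X) {f. \<forall>s\<in>J. apply_bcontfun f s \<in> B s} =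
    prob (sample_path X -` {f. \<forall>s\<in>J. apply_bcontfun f s \<in> B s} \<inter> space M)"
    unfolding path_law_def by (intro measure_distr measurable_sample_path)
  also have "sample_path X -` {f. \<forall>s\<in>J. apply_bcontfun f s \<in> B s} \<inter> space M =
    {\<omega> \<in> space M. \<forall>s\<in>J. X (of_unit s) \<omega> \<in> B s}"
    by (auto simp: sample_path_apply continuous_paths)
  finally show ?thesis .
qed

lemma (in continuous_process) prob_space_path_law: "prob_space (path_law M X)"
  unfolding path_law_def by (rule prob_space_distr[OF measurable_sample_path])

text \<open>The cylinder probabilities agree and determine the law. This links the motion behind the
  ascent, the motion \<open>W\<close> on another space, and the rescaled past.\<close>

lemma path_law_brownian_motion_unique:
  assumes "standard_brownian_motion M X" "standard_brownian_motion M' X'"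
  shows "path_law M X = path_law M' X'"
proof (rule measure_eqI_generator_eq[OF Int_stable_cylinders, where \<Omega>=UNIV and A="\<lambda>_. UNIV"])
  interpret X: standard_brownian_motion M X by fact
  interpret X': standard_brownian_motion M' X' by fact
  interpret l: prob_space "path_law M X" by (rule X.prob_space_path_law)
  interpret l': prob_space "path_law M' X'" by (rule X'.prob_space_path_law)
  show "sets (path_law M X) = sigma_sets UNIV cylinders"
    "sets (path_law M' X') = sigma_sets UNIV cylinders"
    by (simp_all add: path_law_def sets_borel_paths)
  show "range (\<lambda>_. UNIV) \<subseteq> cylinders"
    by (auto simp: cylinders_def intro!: exI[of _ "{}"] exI[of _ "\<lambda>_. UNIV"])
  show "emeasure (path_law M X) UNIV \<noteq> \<infinity>" by simp
  fix A assume "A \<in> cylinders"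
  then obtain J B where J: "finite J" "\<And>s. B s \<in> sets borel"
    and A: "A = {f. \<forall>s\<in>J. apply_bcontfun f s \<in> B s}"
    unfolding cylinders_def by auto
  obtain t n where t: "t 0 = 0" "t n = 1" "\<And>k. k < n \<Longrightarrow> t k < t (Suc k)" "of_unit ` J \<subseteq> t ` {..n}"
    using finite_subset_grid[of "of_unit ` J" 0 1] J of_unit_mem
    by (metis finite_imageI image_subset_iff zero_less_one)
  then have n: "0 < n" by (cases n) auto
  have "\<forall>s\<in>J. \<exists>k\<le>n. of_unit s = t k" using t(4) by auto
  then obtain i where i: "\<And>s. s \<in> J \<Longrightarrow> i s \<le> n" "\<And>s. s \<in> J \<Longrightarrow> of_unit s = t (i s)"
    by metis
  have "measure (path_law M X) A = X.prob {\<omega> \<in> space M. \<forall>s\<in>J. X (t (i s)) \<omega> \<in> B s}"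
    unfolding A X.path_law_cylinder[OF J] using i by simp
  also have "\<dots> = measure (PiM {..<n} (\<lambda>k. density lborel (normal_density 0 (sqrt (t (Suc k) - t k)))))
      {v \<in> space (PiM {..<n} (\<lambda>_. borel)). \<forall>s\<in>J. (\<Sum>k<i s. v k) \<in> B s}"
    by (rule X.prob_cylinder_grid) (use t n J i in simp_all)
  also have "\<dots> = X'.prob {\<omega> \<in> space M'. \<forall>s\<in>J. X' (t (i s)) \<omega> \<in> B s}"
    by (rule X'.prob_cylinder_grid[symmetric]) (use t n J i in simp_all)
  also have "\<dots> = measure (path_law M' X') A"
    unfolding A X'.path_law_cylinder[OF J] using i by simp
  finally show "emeasure (path_law M X) A = emeasure (path_law M' X') A"
    by (simp add: l.emeasure_eq_measure l'.emeasure_eq_measure)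
qed (auto simp: cylinders_def)

text \<open>Brownian scaling of the path on [0,t]. Division by 0 makes \<open>past X 0\<close> the
  zero path, so a continuous path results for every t in [0,1]; with t = \<Theta> it is the right
  side of the theorem.\<close>

definition past :: "(real \<Rightarrow> 'a \<Rightarrow> real) \<Rightarrow> real \<Rightarrow> real \<Rightarrow> 'a \<Rightarrow> real"
  where "past X t s \<omega> = X (s * t) \<omega> / sqrt t"

text \<open>Time is stretched to [0,1] so that the future lives in the same path space, but values
  are not rescaled. Hence a factor \<open>sqrt t\<close> appears whenever it is compared with
  \<open>past\<close>.\<close>

definition future :: "(real \<Rightarrow> 'a \<Rightarrow> real) \<Rightarrow> real \<Rightarrow> real \<Rightarrow> 'a \<Rightarrow> real"
  where "future X t s \<omega> = X (t + s * (1 - t)) \<omega> - X t \<omega>"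

lemma past_time: "s \<in> {0..1} \<Longrightarrow> t \<in> {0..1} \<Longrightarrow> s * t \<in> {0..1::real}"
  by (auto simp: mult_le_one)

lemma future_time:
  assumes "s \<in> {0..1}" "t \<in> {0..1}"
  shows "t + s * (1 - t) \<in> {t..1::real}"
proof -
  have "s * (1 - t) \<le> 1 * (1 - t)" using assms by (intro mult_right_mono) auto
  then show ?thesis using assms by auto
qed

lemma (in continuous_process) continuous_process_past:
  assumes "t \<in> {0..1}"
  shows "continuous_process M (past X t)"
proof
  fix s :: real assume "s \<in> {0..1}"
  then have [measurable]: "X (s * t) \<in> borel_measurable M"
    using assms by (intro measurable_process past_time)
  show "past X t s \<in> borel_measurable M"
    unfolding past_def[abs_def] by measurable
next
  fix \<omega> assume "\<omega> \<in> space M"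
  show "continuous_on {0..1} (\<lambda>s. past X t s \<omega>)"
    \<comment> \<open>As multiplication by the constant \<open>inverse (sqrt t)\<close>, continuity
      also covers t = 0, where the rule for quotients would ask for a nonzero denominator.\<close>
    unfolding past_def divide_inverse
    by (intro continuous_intros continuous_on_compose2[OF continuous_paths[OF \<open>\<omega> \<in> space M\<close>]])
      (use assms past_time in blast)
qed

lemma (in continuous_process) continuous_process_future:
  assumes "t \<in> {0..1}"
  shows "continuous_process M (future X t)"
proof
  fix s :: real assume s: "s \<in> {0..1}"
  have [measurable]: "X (t + s * (1 - t)) \<in> borel_measurable M" "X t \<in> borel_measurable M"
    using future_time[OF s assms] assms by (auto intro!: measurable_process)
  show "future X t s \<in> borel_measurable M"
    unfolding future_def[abs_def] by measurable
next
  fix \<omega> assume "\<omega> \<in> space M"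
  have "(\<lambda>s. t + s * (1 - t)) ` {0..1} \<subseteq> {0..1}"
    using future_time[OF _ assms] assms by fastforce
  then show "continuous_on {0..1} (\<lambda>s. future X t s \<omega>)"
    unfolding future_def
    by (intro continuous_intros continuous_on_compose2[OF continuous_paths[OF \<open>\<omega> \<in> space M\<close>]])
qed

lemma (in continuous_process) sample_path_past:
  assumes "t \<in> {0..1}" "\<omega> \<in> space M"
  shows "apply_bcontfun (sample_path (past X t) \<omega>) s = X (of_unit s * t) \<omega> / sqrt t"
  using continuous_process.continuous_paths[OF continuous_process_past] assms
  by (subst sample_path_apply) (auto simp: past_def)

lemma (in continuous_process) sample_path_future:
  assumes "t \<in> {0..1}" "\<omega> \<in> space M"
  shows "apply_bcontfun (sample_path (future X t) \<omega>) s = X (t + of_unit s * (1 - t)) \<omega> - X t \<omega>"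
  using continuous_process.continuous_paths[OF continuous_process_future] assms
  by (subst sample_path_apply) (auto simp: future_def)

context standard_brownian_motion
begin

lemma standard_brownian_motion_past:
  assumes t: "0 < t" "t \<le> 1"
  shows "standard_brownian_motion M (past X t)"
proof -
  interpret past: continuous_process M "past X t"
    using t by (intro continuous_process_past) auto
  \<comment> \<open>The summand 0 gives the affine shape that \<open>normal_density_affine\<close>
    expects.\<close>
  have diff: "past X t v \<omega> - past X t u \<omega> = 0 + (1 / sqrt t) * (X (v * t) \<omega> - X (u * t) \<omega>)" for u v \<omega>
    by (simp add: past_def diff_divide_distrib)
  show ?thesis
  proof
    show "AE \<omega> in M. past X t 0 \<omega> = 0"
      using starts_at_zero by eventually_elim (simp add: past_def)
  next
    fix u v :: real assume uv: "0 \<le> u" "u < v" "v \<le> 1"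
    have "distributed M lborel (\<lambda>\<omega>. past X t v \<omega> - past X t u \<omega>)
      (normal_density (0 + (1 / sqrt t) * 0) (\<bar>1 / sqrt t\<bar> * sqrt (v * t - u * t)))"
      unfolding diff using uv t
      by (intro normal_density_affine gaussian_increments) (auto simp: mult_le_one)
    also have "\<bar>1 / sqrt t\<bar> * sqrt (v * t - u * t) = sqrt (v - u)"
      using t by (simp add: left_diff_distrib[symmetric] real_sqrt_mult)
    finally show "distributed M lborel (\<lambda>\<omega>. past X t v \<omega> - past X t u \<omega>)
      (normal_density 0 (sqrt (v - u)))"
      by simp
  next
    fix u :: "nat \<Rightarrow> real" and n
    assume u: "0 \<le> u 0" "\<And>i. i < n \<Longrightarrow> u i < u (Suc i)" "u n \<le> 1"
    have mono: "u k \<le> u l" if "k \<le> l" "l \<le> n" for k l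
      using grid_mono[of n u] u(2) that by blast
    have "u n * t \<le> 1"
      using u t mono[of 0 n] by (intro mult_le_one) auto
    then have "indep_vars (\<lambda>_. borel) (\<lambda>i \<omega>. X (u (Suc i) * t) \<omega> - X (u i * t) \<omega>) {..<n}"
      using u t by (intro independent_increments[of "\<lambda>i. u i * t"]) auto
    then show "indep_vars (\<lambda>_. borel) (\<lambda>i \<omega>. past X t (u (Suc i)) \<omega> - past X t (u i) \<omega>) {..<n}"
      unfolding diff by (rule indep_vars_compose2[where Y="\<lambda>_ x. 0 + 1 / sqrt t * x"]) auto
  qed
qed

text \<open>The preimages of cylinders form \<pi>-systems that generate both \<sigma>-algebras, so
  independence on cylinders extends to all Borel sets of paths.\<close>

lemma indep_var_past_future:
  assumes t: "0 < t" "t < 1"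
  shows "indep_var borel (sample_path (past X t)) borel (sample_path (future X t))"
proof -
  interpret past: continuous_process M "past X t"
    using t by (intro continuous_process_past) auto
  interpret future: continuous_process M "future X t"
    using t by (intro continuous_process_future) auto
  let ?P = "sample_path (past X t)" and ?F = "sample_path (future X t)"
  note m = past.measurable_sample_path future.measurable_sample_path
  have gen: "sigma_sets (space M) {Y -` A \<inter> space M | A. A \<in> sets borel} =
      sigma_sets (space M) {Y -` A \<inter> space M | A. A \<in> cylinders}"
    for Y :: "'a \<Rightarrow> unit_interval \<Rightarrow>\<^sub>C real"
  proof -
    have *: "{Y -` A \<inter> space M | A. A \<in> sets borel} =
      sigma_sets (space M) {Y -` A \<inter> space M | A. A \<in> cylinders}"
      unfolding sets_borel_paths by (rule sigma_sets_vimage_commute) auto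
    show ?thesis
      unfolding * by (rule sigma_sets_sigma_sets_eq) auto
  qed
  have int: "Int_stable {Y -` A \<inter> space M | A. A \<in> cylinders}"
    for Y :: "'a \<Rightarrow> unit_interval \<Rightarrow>\<^sub>C real"
  proof (rule Int_stableI, safe)
    fix A A' assume "A \<in> cylinders" "A' \<in> cylinders"
    then have "A \<inter> A' \<in> cylinders"
      using Int_stable_cylinders by (auto simp: Int_stable_def)
    then show "\<exists>A''. Y -` A \<inter> space M \<inter> (Y -` A' \<inter> space M) = Y -` A'' \<inter> space M \<and> A'' \<in> cylinders"
      by (intro exI[of _ "A \<inter> A'"]) auto
  qed
  have "indep_set {?P -` A \<inter> space M | A. A \<in> cylinders} {?F -` A \<inter> space M | A. A \<in> cylinders}"
  proof (rule indep_setI)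
    have "A \<in> sets borel" if "A \<in> cylinders" for A
      using that by (auto simp: sets_borel_paths)
    then show "{?P -` A \<inter> space M | A. A \<in> cylinders} \<subseteq> events"
      "{?F -` A \<inter> space M | A. A \<in> cylinders} \<subseteq> events"
      using m by (auto intro: measurable_sets)
  next
    fix a b assume "a \<in> {?P -` A \<inter> space M | A. A \<in> cylinders}"
      "b \<in> {?F -` A \<inter> space M | A. A \<in> cylinders}"
    then obtain I B J C where I: "finite I" "\<And>s. B s \<in> sets borel"
        "a = ?P -` {f. \<forall>s\<in>I. apply_bcontfun f s \<in> B s} \<inter> space M"
      and J: "finite J" "\<And>s. C s \<in> sets borel"
        "b = ?F -` {f. \<forall>s\<in>J. apply_bcontfun f s \<in> C s} \<inter> space M"
      unfolding cylinders_def by blast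
    \<comment> \<open>The scaling by \<open>sqrt t\<close> is absorbed into the target sets, leaving
      a cylinder event of \<open>X\<close> itself.\<close>
    have a: "a = {\<omega> \<in> space M. \<forall>s\<in>I. X (of_unit s * t) \<omega> \<in> (\<lambda>x. x / sqrt t) -` B s}"
      unfolding I by (use t in \<open>auto simp: sample_path_past\<close>)
    have b: "b = {\<omega> \<in> space M. \<forall>s\<in>J. X (t + of_unit s * (1 - t)) \<omega> - X t \<omega> \<in> C s}"
      unfolding J by (use t in \<open>auto simp: sample_path_future\<close>)
    show "prob (a \<inter> b) = prob a * prob b"
      unfolding a b
    proof (rule prob_past_future_cylinders[OF t I(1) _ _ J(1)])
      fix s
      show "of_unit s * t \<in> {0..t}"
        using of_unit_mem[of s] t by (auto intro: mult_left_le_one_le)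
      show "t + of_unit s * (1 - t) \<in> {t..1}"
        using of_unit_mem[of s] t by (intro future_time) auto
      have "(\<lambda>x. x / sqrt t) \<in> borel_measurable borel" by measurable
      from measurable_sets[OF this I(2)[of s]] show "(\<lambda>x. x / sqrt t) -` B s \<in> sets borel"
        by simp
    qed (rule J)
  qed
  then show ?thesis
    unfolding indep_var_eq gen using m int by (intro conjI indep_set_sigma_sets) auto
qed

end

section \<open>The argmax of Brownian motion\<close>

text \<open>Fubini for the joint law, which is a product by independence: \<open>Z\<close> is frozen
  and \<open>Y\<close> integrated out. It replaces conditional expectation given the future.\<close>

lemma (in prob_space) expectation_indep_var:
  fixes h :: "'b \<times> 'b \<Rightarrow> real"
  assumes indep: "indep_var S Y T Z"
    and h [measurable]: "h \<in> borel_measurable (S \<Otimes>\<^sub>M T)" and bound: "\<And>z. \<bar>h z\<bar> \<le> c"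
  shows "expectation (\<lambda>\<omega>. h (Y \<omega>, Z \<omega>)) = expectation (\<lambda>\<omega>. \<integral>y. h (y, Z \<omega>) \<partial>distr M S Y)"
proof -
  have [measurable]: "Y \<in> M \<rightarrow>\<^sub>M S" "Z \<in> M \<rightarrow>\<^sub>M T"
    using indep by (auto simp: indep_var_eq)
  interpret Y: prob_space "distr M S Y" by (rule prob_space_distr) measurable
  interpret Z: prob_space "distr M T Z" by (rule prob_space_distr) measurable
  interpret YZ: pair_prob_space "distr M S Y" "distr M T Z" ..
  have meas: "h \<in> borel_measurable (distr M S Y \<Otimes>\<^sub>M distr M T Z)"
    by simp
  have int: "integrable (distr M S Y \<Otimes>\<^sub>M distr M T Z) h"
    using meas bound by (intro YZ.integrable_const_bound[where B=c]) auto
  have "expectation (\<lambda>\<omega>. h (Y \<omega>, Z \<omega>)) = (\<integral>z. h z \<partial>distr M (S \<Otimes>\<^sub>M T) (\<lambda>\<omega>. (Y \<omega>, Z \<omega>)))"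
    by (simp add: integral_distr)
  also have "\<dots> = (\<integral>z. h z \<partial>(distr M S Y \<Otimes>\<^sub>M distr M T Z))"
    using indep by (simp add: indep_var_distribution_eq)
  also have "\<dots> = (\<integral>z. (\<integral>y. h (y, z) \<partial>distr M S Y) \<partial>distr M T Z)"
    using YZ.integral_snd[of "\<lambda>y z. h (y, z)"] int by simp
  also have "\<dots> = expectation (\<lambda>\<omega>. \<integral>y. h (y, Z \<omega>) \<partial>distr M S Y)"
  proof (rule integral_distr)
    have "(\<lambda>(z, y). h (y, z)) \<in> borel_measurable (T \<Otimes>\<^sub>M distr M S Y)" by measurable
    then show "(\<lambda>z. \<integral>y. h (y, z) \<partial>distr M S Y) \<in> borel_measurable T"
      by (rule Y.borel_measurable_lebesgue_integral)
  qed measurable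
  finally show ?thesis .
qed

lemma (in prob_space) indep_var_sym:
  assumes "indep_var S Y T Z"
  shows "indep_var T Z S Y"
proof -
  have "indep_set B A" if "indep_set A B" for A B
    using indep_setD_ev1[OF that] indep_setD_ev2[OF that] indep_setD[OF that]
    by (intro indep_setI) (metis Int_commute mult.commute)+
  then show ?thesis
    using assms by (auto simp: indep_var_eq)
qed

text \<open>With \<open>Z\<close> frozen at z, the event is that \<open>Y\<close> hits z, which is
  null; integrating over \<open>Z\<close> shows that the diagonal is null.\<close>

lemma (in prob_space) AE_indep_var_neq:
  fixes Y Z :: "'a \<Rightarrow> real"
  assumes indep: "indep_var borel Y borel Z" and no_atom: "\<And>y. AE \<omega> in M. Y \<omega> \<noteq> y"
  shows "AE \<omega> in M. Y \<omega> \<noteq> Z \<omega>"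
proof -
  have [measurable]: "Y \<in> borel_measurable M" "Z \<in> borel_measurable M"
    using indep by (auto simp: indep_var_eq)
  let ?D = "{z :: real \<times> real. fst z = snd z}"
  have [measurable]: "?D \<in> sets (borel \<Otimes>\<^sub>M borel)"
    unfolding borel_prod by (intro borel_closed closed_Collect_eq continuous_intros)
  have "(\<integral>y. indicat_real ?D (y, z) \<partial>distr M borel Y) = 0" for z
  proof -
    have "AE y in distr M borel Y. y \<noteq> z"
      using no_atom by (simp add: AE_distr_iff)
    then have "AE y in distr M borel Y. indicat_real ?D (y, z) = 0"
      by eventually_elim (simp add: indicator_def)
    then show ?thesis by (rule integral_eq_zero_AE)
  qed
  then have "expectation (\<lambda>\<omega>. indicat_real ?D (Y \<omega>, Z \<omega>)) = 0"
    by (subst expectation_indep_var[OF indep, where c=1]) auto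
  also have "(\<lambda>\<omega>. indicat_real ?D (Y \<omega>, Z \<omega>)) = indicat_real {\<omega>. Y \<omega> = Z \<omega>}"
    by (auto simp: indicator_def)
  finally have "prob {\<omega> \<in> space M. Y \<omega> = Z \<omega>} = 0"
    by (simp add: Collect_conj_eq Int_commute)
  then show ?thesis
    by (simp add: prob_eq_0)
qed

definition max_on :: "(real \<Rightarrow> 'a \<Rightarrow> real) \<Rightarrow> real \<Rightarrow> real \<Rightarrow> 'a \<Rightarrow> real"
  where "max_on X a b \<omega> = (SUP r\<in>{a..b}. X r \<omega>)"

lemma max_on_eqI:
  assumes "r \<in> {a..b}" "\<And>u. u \<in> {a..b} \<Longrightarrow> X u \<omega> \<le> X r \<omega>"
  shows "max_on X a b \<omega> = X r \<omega>"
  unfolding max_on_def using assms by (intro cSup_eq_maximum) auto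

text \<open>On a sample path of X this is the variable S_1 - X_1 that is conditioned to be small in
  the definition of the ascent.\<close>

definition drawdown :: "(unit_interval \<Rightarrow>\<^sub>C real) \<Rightarrow> real"
  where "drawdown f = path_sup {0..1} f - apply_bcontfun f (to_unit 1)"

lemma measurable_drawdown [measurable]: "drawdown \<in> borel_measurable borel"
  unfolding drawdown_def[abs_def] by measurable

context continuous_process
begin

lemma max_on_attained:
  assumes "0 \<le> a" "a \<le> b" "b \<le> 1" "\<omega> \<in> space M"
  obtains r where "r \<in> {a..b}" "max_on X a b \<omega> = X r \<omega>" "\<And>u. u \<in> {a..b} \<Longrightarrow> X u \<omega> \<le> X r \<omega>"
proof -
  have "continuous_on {a..b} (\<lambda>r. X r \<omega>)"
    using assms by (intro continuous_on_subset[OF continuous_paths]) auto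
  from continuous_attains_sup[OF _ _ this] assms
  obtain r where "r \<in> {a..b}" "\<forall>u\<in>{a..b}. X u \<omega> \<le> X r \<omega>"
    by auto
  then show ?thesis by (intro that[of r] max_on_eqI) auto
qed

lemma max_on_upper:
  assumes "0 \<le> a" "b \<le> 1" "\<omega> \<in> space M" "u \<in> {a..b}"
  shows "X u \<omega> \<le> max_on X a b \<omega>"
proof -
  have "a \<le> b" using assms by auto
  then obtain r where "max_on X a b \<omega> = X r \<omega>" "\<And>u. u \<in> {a..b} \<Longrightarrow> X u \<omega> \<le> X r \<omega>"
    using max_on_attained[OF assms(1) _ assms(2,3)] by metis
  then show ?thesis using assms by simp
qed

lemma sample_path_coordinate:
  "\<omega> \<in> space M \<Longrightarrow> apply_bcontfun (sample_path X \<omega>) s = X (of_unit s) \<omega>"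
  by (intro sample_path_apply continuous_paths)

lemma path_sup_sample_path:
  assumes "\<omega> \<in> space M"
  shows "path_sup {0..1} (sample_path X \<omega>) = max_on X 0 1 \<omega>"
  unfolding path_sup_def max_on_def
  by (intro SUP_cong) (auto simp: sample_path_coordinate assms)

lemma path_sup_past:
  assumes t: "0 < t" "t \<le> 1" and \<omega>: "\<omega> \<in> space M"
  shows "path_sup {0..1} (sample_path (past X t) \<omega>) = max_on X 0 t \<omega> / sqrt t"
proof -
  obtain r where r: "r \<in> {0..t}" "max_on X 0 t \<omega> = X r \<omega>" "\<And>u. u \<in> {0..t} \<Longrightarrow> X u \<omega> \<le> X r \<omega>"
    using max_on_attained[of 0 t \<omega>] t \<omega> by auto
  have *: "apply_bcontfun (sample_path (past X t) \<omega>) (to_unit s) = X (s * t) \<omega> / sqrt t"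
    if "s \<in> {0..1}" for s
    using that t \<omega> by (simp add: sample_path_past)
  have r': "r / t \<in> {0..1}"
    using r t by auto
  have "path_sup {0..1} (sample_path (past X t) \<omega>) =
    apply_bcontfun (sample_path (past X t) \<omega>) (to_unit (r / t))"
  proof (rule path_sup_eqI[OF r'])
    fix u :: real assume u: "u \<in> {0..1}"
    then have "u * t \<in> {0..t}"
      using t by (auto intro: mult_left_le_one_le)
    then show "apply_bcontfun (sample_path (past X t) \<omega>) (to_unit u)
      \<le> apply_bcontfun (sample_path (past X t) \<omega>) (to_unit (r / t))"
      unfolding *[OF u] *[OF r'] using t r(3) by (auto intro: divide_right_mono)
  qed
  then show ?thesis unfolding *[OF r'] r(2) using t by simp
qed

lemma drawdown_past:
  assumes t: "0 < t" "t \<le> 1" and \<omega>: "\<omega> \<in> space M"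
  shows "drawdown (sample_path (past X t) \<omega>) = (max_on X 0 t \<omega> - X t \<omega>) / sqrt t"
  using assms by (simp add: drawdown_def path_sup_past sample_path_past diff_divide_distrib)

lemma path_sup_future:
  assumes t: "0 \<le> t" "t < 1" and ab: "t \<le> a" "a \<le> b" "b \<le> 1" and \<omega>: "\<omega> \<in> space M"
  shows "path_sup {(a - t) / (1 - t)..(b - t) / (1 - t)} (sample_path (future X t) \<omega>) =
    max_on X a b \<omega> - X t \<omega>"
proof -
  let ?K = "{(a - t) / (1 - t)..(b - t) / (1 - t)}"
  obtain r where r: "r \<in> {a..b}" "max_on X a b \<omega> = X r \<omega>" "\<And>u. u \<in> {a..b} \<Longrightarrow> X u \<omega> \<le> X r \<omega>"
    using max_on_attained[of a b \<omega>] t ab \<omega> by auto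
  have K: "t + s * (1 - t) \<in> {a..b}" "s \<in> {0..1}" if "s \<in> ?K" for s
  proof -
    show 1: "t + s * (1 - t) \<in> {a..b}"
      using that t by (auto simp: field_simps)
    have "0 \<le> (a - t) / (1 - t)" "(b - t) / (1 - t) \<le> 1"
      using t ab by auto
    then show "s \<in> {0..1}" using that by auto
  qed
  have *: "apply_bcontfun (sample_path (future X t) \<omega>) (to_unit s) = X (t + s * (1 - t)) \<omega> - X t \<omega>"
    if "s \<in> ?K" for s
    using K[OF that] t \<omega> by (simp add: sample_path_future)
  have r': "(r - t) / (1 - t) \<in> ?K"
    using r(1) t by (auto intro: divide_right_mono)
  have "path_sup ?K (sample_path (future X t) \<omega>) =
    apply_bcontfun (sample_path (future X t) \<omega>) (to_unit ((r - t) / (1 - t)))"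
  proof (rule path_sup_eqI[OF r'])
    fix u :: real assume u: "u \<in> ?K"
    show "apply_bcontfun (sample_path (future X t) \<omega>) (to_unit u)
      \<le> apply_bcontfun (sample_path (future X t) \<omega>) (to_unit ((r - t) / (1 - t)))"
      unfolding *[OF u] *[OF r'] using t r(3)[OF K(1)[OF u]] by simp
  qed
  then show ?thesis unfolding *[OF r'] r(2) using t by simp
qed

end

context standard_brownian_motion
begin

lemma AE_increment_neq:
  assumes "0 \<le> s" "s < t" "t \<le> 1"
  shows "AE \<omega> in M. X t \<omega> - X s \<omega> \<noteq> y"
proof -
  have "AE x in lborel. 0 < ennreal (normal_density 0 (sqrt (t - s)) x) \<longrightarrow> x \<noteq> y"
    using AE_lborel_singleton[of y] by eventually_elim simp
  then show ?thesis
    by (subst distributed_AE2[OF gaussian_increments[OF assms]]) auto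
qed

text \<open>
  The difference \<open>max\<^bsub>[q',1]\<^esub> X - X\<^sub>q\<close> contains the increment over \<open>[q,q']\<close> as an independent
  summand, hence has no atoms, and it is independent of \<open>max\<^bsub>[0,q]\<^esub> X - X\<^sub>q\<close>.
\<close>

lemma AE_max_on_neq:
  assumes q: "0 < q" "q < q'" "q' < 1"
  shows "AE \<omega> in M. max_on X 0 q \<omega> \<noteq> max_on X q' 1 \<omega>"
proof -
  have q': "0 < q'" "q' < 1" "q < 1" using q by auto
  \<comment> \<open>The time q' on the clock of the future at q.\<close>
  let ?c = "(q' - q) / (1 - q)"
  have incr: "X q' \<omega> - X q \<omega> = sqrt q' * (apply_bcontfun (sample_path (past X q') \<omega>) (to_unit 1) -
      apply_bcontfun (sample_path (past X q') \<omega>) (to_unit (q / q')))" if "\<omega> \<in> space M" for \<omega>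
  proof -
    have "q / q' \<in> {0..1}" using q by auto
    then show ?thesis
      using that q by (simp add: sample_path_past right_diff_distrib)
  qed
  have fut: "path_sup {?c..1} (sample_path (future X q) \<omega>) = max_on X q' 1 \<omega> - X q \<omega>"
    "path_sup {0..1} (sample_path (future X q') \<omega>) = max_on X q' 1 \<omega> - X q' \<omega>"
    if "\<omega> \<in> space M" for \<omega>
    using path_sup_future[of q q' 1 \<omega>] path_sup_future[of q' q' 1 \<omega>] q that by auto
  have no_atom: "AE \<omega> in M. path_sup {?c..1} (sample_path (future X q) \<omega>) \<noteq> y" for y
  proof -
    let ?D = "\<lambda>p. sqrt q' * (apply_bcontfun p (to_unit 1) - apply_bcontfun p (to_unit (q / q')))"
    have "indep_var borel (?D \<circ> sample_path (past X q')) borel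
      ((\<lambda>p. y - path_sup {0..1} p) \<circ> sample_path (future X q'))"
      by (rule indep_var_compose[OF indep_var_past_future[OF q'(1,2)]]) measurable
    moreover have "AE \<omega> in M. (?D \<circ> sample_path (past X q')) \<omega> \<noteq> y'" for y'
      using AE_increment_neq[of q q' y'] q AE_space
      by (auto elim!: eventually_elim2 simp: incr)
    ultimately have "AE \<omega> in M. (?D \<circ> sample_path (past X q')) \<omega> \<noteq>
        ((\<lambda>p. y - path_sup {0..1} p) \<circ> sample_path (future X q')) \<omega>"
      by (rule AE_indep_var_neq)
    then show ?thesis
      using AE_space
      by eventually_elim (use fut in \<open>simp add: incr[symmetric]\<close>)
  qed
  have "indep_var borel ((\<lambda>p. sqrt q * drawdown p) \<circ> sample_path (past X q)) borel
    (path_sup {?c..1} \<circ> sample_path (future X q))"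
    by (rule indep_var_compose[OF indep_var_past_future[OF q(1) q'(3)]]) measurable
  then have "indep_var borel (path_sup {?c..1} \<circ> sample_path (future X q)) borel
    ((\<lambda>p. sqrt q * drawdown p) \<circ> sample_path (past X q))"
    by (rule indep_var_sym)
  then have "AE \<omega> in M. (path_sup {?c..1} \<circ> sample_path (future X q)) \<omega> \<noteq>
    ((\<lambda>p. sqrt q * drawdown p) \<circ> sample_path (past X q)) \<omega>"
    by (rule AE_indep_var_neq) (use no_atom in simp)
  then show ?thesis
    using AE_space
    by eventually_elim (use fut q in \<open>auto simp: drawdown_past\<close>)
qed

text \<open>Two maximisers s < u are separated by rationals q < q', and then the maxima over [0,q]
  and [q',1] coincide. \<open>AE_max_on_neq\<close> excludes this simultaneously for the countably
  many pairs.\<close>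

lemma AE_unique_arg_max:
  "AE \<omega> in M. \<forall>s\<in>{0..1}. \<forall>u\<in>{0..1}. X s \<omega> = max_on X 0 1 \<omega> \<longrightarrow> X u \<omega> = max_on X 0 1 \<omega> \<longrightarrow> s = u"
proof -
  have "AE \<omega> in M. \<forall>q\<in>\<rat>. \<forall>q'\<in>\<rat>. 0 < q \<longrightarrow> q < q' \<longrightarrow> q' < 1 \<longrightarrow> max_on X 0 q \<omega> \<noteq> max_on X q' 1 \<omega>"
    using AE_max_on_neq by (intro AE_ball_countable[THEN iffD2] ballI countable_rat) auto
  then show ?thesis
    using AE_space
  proof eventually_elim
    case (elim \<omega>)
    have False if su: "s \<in> {0..1}" "u \<in> {0..1}" "X s \<omega> = max_on X 0 1 \<omega>" "X u \<omega> = max_on X 0 1 \<omega>" "s < u"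
      for s u
    proof -
      obtain q where q: "q \<in> \<rat>" "s < q" "q < u" using Rats_dense_in_real[OF \<open>s < u\<close>] by blast
      obtain q' where q': "q' \<in> \<rat>" "q < q'" "q' < u" using Rats_dense_in_real[OF \<open>q < u\<close>] by blast
      have "X r \<omega> \<le> max_on X 0 1 \<omega>" if "r \<in> {0..1}" for r
        using that elim by (intro max_on_upper) auto
      then have "max_on X 0 q \<omega> = X s \<omega>" "max_on X q' 1 \<omega> = X u \<omega>"
        using su q q' by (intro max_on_eqI; simp)+
      then show False using elim(1) q q' su by fastforce
    qed
    then show ?case
      by (meson linorder_neqE)
  qed
qed

lemma prob_increment_gt_pos:
  assumes "0 \<le> s" "s < t" "t \<le> 1"
  shows "0 < prob {\<omega> \<in> space M. X t \<omega> - X s \<omega> > y}"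
proof (rule ccontr)
  have [measurable]: "X t \<in> borel_measurable M" "X s \<in> borel_measurable M"
    using assms by (auto intro: measurable_process)
  assume "\<not> ?thesis"
  then have "prob {\<omega> \<in> space M. X t \<omega> - X s \<omega> > y} = 0"
    by (simp add: not_less measure_le_0_iff)
  then have "AE \<omega> in M. \<not> (X t \<omega> - X s \<omega> > y)"
    by (subst (asm) prob_eq_0) auto
  then have "AE x in lborel. 0 < ennreal (normal_density 0 (sqrt (t - s)) x) \<longrightarrow> \<not> (x > y)"
    by (subst (asm) distributed_AE2[OF gaussian_increments[OF assms]]) auto
  then have "AE x in lborel. x \<notin> {y<..}"
    using assms by (auto elim!: eventually_mono simp: normal_density_pos)
  then have "emeasure lborel {y<..<y+1} = 0"
    by (intro AE_iff_measurable[THEN iffD1, of _ lborel "\<lambda>x. x \<notin> {y<..<y+1}"])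
      (auto elim!: eventually_mono)
  then show False by simp
qed

text \<open>
  By scaling, the events that \<open>X\<close> stays nonpositive on \<open>[0,1]\<close> and on \<open>[0,1/2]\<close> have the same
  probability. If it were positive, a large independent increment over \<open>[1/2,1]\<close> would separate them.
\<close>

lemma AE_max_on_pos: "AE \<omega> in M. 0 < max_on X 0 1 \<omega>"
proof -
  let ?P = "sample_path (past X (1/2))" and ?F = "sample_path (future X (1/2))"
  interpret past: standard_brownian_motion M "past X (1/2)"
    by (rule standard_brownian_motion_past) auto
  have indep: "indep_var borel ?P borel ?F"
    by (rule indep_var_past_future) auto
  note [measurable] = measurable_sample_path
  have [measurable]: "?P \<in> borel_measurable M" "?F \<in> borel_measurable M"
    using indep by (auto simp: indep_var_eq)
  let ?A = "{p. path_sup {0..1} p \<le> 0}"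
  have A: "?A \<in> sets borel" by measurable
  define E1 where "E1 = {\<omega> \<in> space M. path_sup {0..1} (sample_path X \<omega>) \<le> 0}"
  define E2 where "E2 = {\<omega> \<in> space M. path_sup {0..1} (?P \<omega>) \<le> 0}"
  have E [measurable]: "E1 \<in> events" "E2 \<in> events"
    unfolding E1_def E2_def by measurable
  have "prob E1 = measure (path_law M X) ?A"
    unfolding path_law_def E1_def
    by (subst measure_distr[OF measurable_sample_path A]) (auto intro: arg_cong[where f=prob])
  also have "\<dots> = measure (path_law M (past X (1/2))) ?A"
    using path_law_brownian_motion_unique[OF standard_brownian_motion_axioms
        past.standard_brownian_motion_axioms] by simp
  also have "\<dots> = prob E2"
    unfolding path_law_def E2_def
    by (subst measure_distr[OF past.measurable_sample_path A]) (auto intro: arg_cong[where f=prob])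
  finally have eq: "prob E1 = prob E2" .
  have sub: "E1 \<subseteq> E2"
  proof
    fix \<omega> assume \<omega>: "\<omega> \<in> E1"
    then have \<omega>': "\<omega> \<in> space M" "max_on X 0 1 \<omega> \<le> 0"
      by (auto simp: E1_def path_sup_sample_path)
    obtain r where "r \<in> {0..1/2}" "max_on X 0 (1/2) \<omega> = X r \<omega>"
      by (rule max_on_attained[of 0 "1/2" \<omega>]) (use \<omega>' in auto)
    then have "max_on X 0 (1/2) \<omega> \<le> 0"
      using max_on_upper[of 0 1 \<omega> r] \<omega>' by auto
    then show "\<omega> \<in> E2"
      using \<omega>' by (auto simp: E2_def path_sup_past intro: divide_nonpos_nonneg)
  qed
  \<comment> \<open>Equal probabilities together with inclusion: almost no path is nonpositive on
    the first half and positive later.\<close>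
  have diff: "prob (E2 - E1) = 0"
    using finite_measure_Diff[OF E(2,1) sub] eq by simp
  have end_value: "apply_bcontfun (?F \<omega>) (to_unit 1) = X 1 \<omega> - X (1/2) \<omega>" if "\<omega> \<in> space M" for \<omega>
    using sample_path_future[of "1/2" \<omega> "to_unit 1"] that by simp
  have zero: "prob {\<omega> \<in> space M. path_sup {0..1} (?P \<omega>) \<le> 0 \<and> - n < apply_bcontfun (?P \<omega>) (to_unit 1)} = 0"
    (is "prob ?B = 0") for n
  proof -
    let ?Ba = "{p. path_sup {0..1} p \<le> 0 \<and> - n < apply_bcontfun p (to_unit 1)}"
    \<comment> \<open>On \<open>?Ba\<close> the unscaled value at 1/2 exceeds
      \<open>- n * sqrt (1/2)\<close>, hence \<open>- \<bar>n\<bar>\<close>, so an increment above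
      \<open>\<bar>n\<bar>\<close> makes \<open>X 1\<close> positive. This increment is independent
      and has positive probability, which forces \<open>?Ba\<close> to be null.\<close>
    let ?Ca = "{p. \<bar>n\<bar> < apply_bcontfun p (to_unit 1)}"
    have "?Ba \<in> sets borel" "?Ca \<in> sets borel" by measurable
    from indep_varD[OF indep this]
    have prod: "prob ((\<lambda>x. (?P x, ?F x)) -` (?Ba \<times> ?Ca) \<inter> space M) =
      prob (?P -` ?Ba \<inter> space M) * prob (?F -` ?Ca \<inter> space M)" .
    have "(\<lambda>x. (?P x, ?F x)) -` (?Ba \<times> ?Ca) \<inter> space M \<subseteq> E2 - E1"
    proof
      fix \<omega> assume \<omega>: "\<omega> \<in> (\<lambda>x. (?P x, ?F x)) -` (?Ba \<times> ?Ca) \<inter> space M"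
      then have "- n < X (1/2) \<omega> / sqrt (1/2)" "\<bar>n\<bar> < X 1 \<omega> - X (1/2) \<omega>" "\<omega> \<in> space M"
        by (auto simp: sample_path_past sample_path_future)
      moreover from this have "- n * sqrt (1/2) < X (1/2) \<omega>"
        by (simp add: field_simps)
      moreover have "n * sqrt (1/2) \<le> \<bar>n\<bar>"
        using mult_mono[of n "\<bar>n\<bar>" "sqrt (1/2)" 1] by simp
      ultimately have "0 < X 1 \<omega>" by simp
      then have "0 < max_on X 0 1 \<omega>"
        using max_on_upper[of 0 1 \<omega> 1] \<omega> by auto
      then show "\<omega> \<in> E2 - E1"
        using \<omega> by (auto simp: E1_def E2_def path_sup_sample_path)
    qed
    from finite_measure_mono[OF this sets.Diff[OF E(2,1)]] diff
    have "prob (?P -` ?Ba \<inter> space M) * prob (?F -` ?Ca \<inter> space M) \<le> 0"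
      by (simp only: prod)
    moreover have "0 < prob (?F -` ?Ca \<inter> space M)"
    proof -
      have "?F -` ?Ca \<inter> space M = {\<omega> \<in> space M. X 1 \<omega> - X (1/2) \<omega> > \<bar>n\<bar>}"
        using end_value by fastforce
      then show ?thesis
        using prob_increment_gt_pos[of "1/2" 1 "\<bar>n\<bar>"] by simp
    qed
    moreover have "a \<le> 0" if "a * b \<le> 0" "0 < b" for a b :: real
      using that by (simp add: mult_le_0_iff)
    ultimately have "prob (?P -` ?Ba \<inter> space M) \<le> 0"
      by blast
    moreover have "?P -` ?Ba \<inter> space M = ?B" by blast
    ultimately show "prob ?B = 0" by (simp add: measure_le_0_iff)
  qed
  have "AE \<omega> in M. \<not> (path_sup {0..1} (?P \<omega>) \<le> 0 \<and> - real n < apply_bcontfun (?P \<omega>) (to_unit 1))" for n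
    using zero[of "real n"] by (subst (asm) prob_eq_0) auto
  then have "AE \<omega> in M. \<forall>n::nat. \<not> (path_sup {0..1} (?P \<omega>) \<le> 0 \<and> - real n < apply_bcontfun (?P \<omega>) (to_unit 1))"
    by (intro AE_all_countable[THEN iffD2] allI)
  then show ?thesis
    using AE_space
  proof eventually_elim
    case (elim \<omega>)
    obtain n :: nat where "- apply_bcontfun (?P \<omega>) (to_unit 1) < real n"
      using reals_Archimedean2 by blast
    then have "- real n < apply_bcontfun (?P \<omega>) (to_unit 1)"
      by linarith
    with elim have "\<not> path_sup {0..1} (?P \<omega>) \<le> 0"
      by blast
    then have "\<omega> \<notin> E1" using sub by (auto simp: E2_def)
    then show ?case using elim by (simp add: E1_def path_sup_sample_path)
  qed
qed

end

section \<open>Grid sums and paths up to a varying time\<close>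

text \<open>The cells are disjoint, so at most one term survives; half-open on the left, the cell of
  \<theta> has index \<lceil>n \<theta>\<rceil> - 1. Cell 0 is left out because its left endpoint 0
  has no rescaled past. For \<theta> \<le> 0, truncation to \<open>nat\<close> yields index 0, which
  is also outside the range.\<close>

lemma sum_grid_cells:
  fixes F :: "real \<Rightarrow> real"
  shows "(\<Sum>k=1..<n. F (real k / real n) * indicator {real k / real n<..real (Suc k) / real n} \<theta>) =
    (if nat \<lceil>real n * \<theta>\<rceil> - 1 \<in> {1..<n} then F (real (nat \<lceil>real n * \<theta>\<rceil> - 1) / real n) else 0)"
proof (cases "n = 0")
  case False
  have "indicator {real k / real n<..real (Suc k) / real n} \<theta> =
    (if k = nat \<lceil>real n * \<theta>\<rceil> - 1 then 1 else 0 :: real)" if "1 \<le> k" for k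
  proof -
    have "\<theta> \<in> {real k / real n<..real (Suc k) / real n} \<longleftrightarrow>
      real k < real n * \<theta> \<and> real n * \<theta> \<le> real (Suc k)"
      using False by (auto simp: field_simps)
    also have "\<dots> \<longleftrightarrow> \<lceil>real n * \<theta>\<rceil> = int (Suc k)"
      by (auto simp: ceiling_eq_iff)
    also have "\<dots> \<longleftrightarrow> k = nat \<lceil>real n * \<theta>\<rceil> - 1"
      using that by linarith
    finally show ?thesis by (simp add: indicator_def)
  qed
  then have "(\<Sum>k=1..<n. F (real k / real n) * indicator {real k / real n<..real (Suc k) / real n} \<theta>) =
    (\<Sum>k=1..<n. if k = nat \<lceil>real n * \<theta>\<rceil> - 1 then F (real k / real n) else 0)"
    by (intro sum.cong) auto
  then show ?thesis by (simp add: sum.delta)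
qed simp

lemma sum_grid_cells_bound:
  fixes F :: "real \<Rightarrow> real"
  assumes "\<And>t. \<bar>F t\<bar> \<le> c"
  shows "\<bar>\<Sum>k=1..<n. F (real k / real n) * indicator {real k / real n<..real (Suc k) / real n} \<theta>\<bar> \<le> c"
  unfolding sum_grid_cells using assms order_trans[OF abs_ge_zero assms] by auto

text \<open>The surviving grid point lies in [\<theta> - 1/n, \<theta>), so it approaches \<theta>
  strictly from the left and a left limit of \<open>F\<close> suffices. The bound n > 1/\<theta>
  keeps \<theta> out of the omitted cell 0.\<close>

lemma sum_grid_cells_tendsto:
  fixes F :: "real \<Rightarrow> real"
  assumes lim: "(F \<longlongrightarrow> L) (at_left \<theta>)" and \<theta>: "0 < \<theta>" "\<theta> \<le> 1"
  shows "(\<lambda>n. \<Sum>k=1..<n. F (real k / real n) * indicator {real k / real n<..real (Suc k) / real n} \<theta>)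
    \<longlonglongrightarrow> L"
proof -
  define \<kappa> where "\<kappa> n = nat \<lceil>real n * \<theta>\<rceil> - 1" for n
  have \<kappa>: "\<kappa> n \<in> {1..<n}" "real (\<kappa> n) / real n < \<theta>" "\<theta> - 1 / real n \<le> real (\<kappa> n) / real n"
    if n: "1 / \<theta> < real n" for n
  proof -
    have n_pos: "0 < real n" using n \<theta> by (meson divide_pos_pos less_trans zero_less_one)
    have gt: "1 < real n * \<theta>" using n \<theta> by (simp add: field_simps)
    have le: "real n * \<theta> \<le> real n" using n_pos \<theta> by simp
    have c: "2 \<le> \<lceil>real n * \<theta>\<rceil>" "\<lceil>real n * \<theta>\<rceil> \<le> int n"
      using gt le by (linarith, simp add: ceiling_le_iff)
    have int_\<kappa>: "int (\<kappa> n) = \<lceil>real n * \<theta>\<rceil> - 1"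
      using c(1) unfolding \<kappa>_def by linarith
    then show "\<kappa> n \<in> {1..<n}"
      using c unfolding atLeastLessThan_iff by linarith
    have "real (\<kappa> n) = of_int (int (\<kappa> n))" by simp
    then have "real (\<kappa> n) = of_int \<lceil>real n * \<theta>\<rceil> - 1"
      unfolding int_\<kappa> by simp
    then have *: "real (\<kappa> n) < real n * \<theta>" "real n * \<theta> - 1 \<le> real (\<kappa> n)"
      by linarith+
    show "real (\<kappa> n) / real n < \<theta>"
      using *(1) n_pos by (simp add: pos_divide_less_eq mult.commute)
    have "\<theta> - 1 / real n = (real n * \<theta> - 1) / real n"
      using n_pos by (simp add: diff_divide_distrib)
    also have "\<dots> \<le> real (\<kappa> n) / real n"
      using *(2) n_pos by (intro divide_right_mono) auto
    finally show "\<theta> - 1 / real n \<le> real (\<kappa> n) / real n" .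
  qed
  have ev: "\<forall>\<^sub>F n in sequentially. 1 / \<theta> < real n"
    using filterlim_real_sequentially by (auto simp: filterlim_at_top_dense)
  have "(\<lambda>n. real (\<kappa> n) / real n) \<longlonglongrightarrow> \<theta>"
  proof (rule tendsto_sandwich)
    show "(\<lambda>n. \<theta> - 1 / real n) \<longlonglongrightarrow> \<theta>"
      using tendsto_diff[OF tendsto_const lim_1_over_n, of \<theta>] by simp
    show "\<forall>\<^sub>F n in sequentially. \<theta> - 1 / real n \<le> real (\<kappa> n) / real n"
      using ev by eventually_elim (rule \<kappa>)
    show "\<forall>\<^sub>F n in sequentially. real (\<kappa> n) / real n \<le> \<theta>"
      using ev by eventually_elim (intro less_imp_le \<kappa>)
  qed simp
  moreover have "\<forall>\<^sub>F n in sequentially. real (\<kappa> n) / real n < \<theta>"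
    using ev by eventually_elim (rule \<kappa>)
  ultimately have "filterlim (\<lambda>n. real (\<kappa> n) / real n) (at_left \<theta>) sequentially"
    unfolding filterlim_at by (auto elim: eventually_mono)
  from filterlim_compose[OF lim this] have "(\<lambda>n. F (real (\<kappa> n) / real n)) \<longlonglongrightarrow> L" .
  moreover have "\<forall>\<^sub>F n in sequentially. F (real (\<kappa> n) / real n) =
    (\<Sum>k=1..<n. F (real k / real n) * indicator {real k / real n<..real (Suc k) / real n} \<theta>)"
    using ev
  proof eventually_elim
    case (elim n)
    show ?case
      unfolding sum_grid_cells using \<kappa>(1)[OF elim] by (simp only: \<kappa>_def if_True)
  qed
  ultimately show ?thesis by (rule Lim_transform_eventually)
qed

text \<open>The map from (s,t) to X(st)/sqrt(t) is uniformly continuous on the compact set [0,1] x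
  [\<theta>/2,1], which avoids t = 0; this gives convergence uniformly in s.\<close>

lemma (in continuous_process) tendsto_sample_path_past:
  assumes \<theta>: "0 < \<theta>" "\<theta> \<le> 1" and \<omega>: "\<omega> \<in> space M"
  shows "((\<lambda>t. sample_path (past X t) \<omega>) \<longlongrightarrow> sample_path (past X \<theta>) \<omega>) (at_left \<theta>)"
proof (rule tendstoI)
  fix e :: real assume e: "0 < e"
  let ?K = "{0..1} \<times> {\<theta>/2..1}" and ?h = "\<lambda>(s, t). X (s * t) \<omega> / sqrt t"
  have "continuous_on ?K (\<lambda>z. X (fst z * snd z) \<omega>)"
    by (rule continuous_on_compose2[OF continuous_paths[OF \<omega>]])
      (use \<theta> in \<open>auto intro!: continuous_intros mult_le_one\<close>)
  then have "continuous_on ?K ?h"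
    unfolding case_prod_beta using \<theta> by (intro continuous_intros) auto
  then have "uniformly_continuous_on ?K ?h"
    by (intro compact_uniformly_continuous compact_Times) auto
  then obtain d where d: "d > 0"
    and dist: "\<forall>z\<in>?K. \<forall>z'\<in>?K. dist z' z < d \<longrightarrow> dist (?h z') (?h z) < e / 2"
    unfolding uniformly_continuous_on_def using half_gt_zero[OF e] by blast
  have "\<forall>\<^sub>F t in at_left \<theta>. t \<in> {max (\<theta>/2) (\<theta> - d)<..<\<theta>}"
    using \<theta> d by (intro eventually_at_leftI[of "max (\<theta>/2) (\<theta> - d)"]) auto
  then show "\<forall>\<^sub>F t in at_left \<theta>. dist (sample_path (past X t) \<omega>) (sample_path (past X \<theta>) \<omega>) < e"
  proof eventually_elim
    case (elim t)
    have "dist (sample_path (past X t) \<omega>) (sample_path (past X \<theta>) \<omega>) \<le> e / 2"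
    proof (rule dist_bound)
      fix s
      have "dist (?h (of_unit s, t)) (?h (of_unit s, \<theta>)) < e / 2"
        using elim \<theta> of_unit_mem[of s]
        by (intro dist[rule_format]) (auto simp: dist_Pair_Pair dist_real_def)
      then show "dist (apply_bcontfun (sample_path (past X t) \<omega>) s)
          (apply_bcontfun (sample_path (past X \<theta>) \<omega>) s) \<le> e / 2"
        using elim \<theta> \<omega> by (simp add: sample_path_past)
    qed
    then show ?case using e by simp
  qed
qed

section \<open>Conditioning on a small final drawdown\<close>

text \<open>A null set \<open>A\<close> is included: the right side is then 0 by division by zero,
  and on the left the density vanishes off the null set \<open>A\<close>.\<close>

lemma integral_uniform_measure:
  fixes f :: "'a \<Rightarrow> real"
  assumes "finite_measure M" "A \<in> sets M" "f \<in> borel_measurable M"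
  shows "(\<integral>x. f x \<partial>uniform_measure M A) = (\<integral>x. f x * indicator A x \<partial>M) / measure M A"
proof -
  interpret finite_measure M by fact
  show ?thesis
  proof (cases "measure M A = 0")
    case True
    then have "AE x in M. x \<notin> A"
      using assms by (intro AE_not_in null_setsI) (auto simp: emeasure_eq_measure)
    then have "AE x in uniform_measure M A. f x = 0"
      unfolding uniform_measure_def using assms
      by (subst AE_density) (auto elim!: eventually_mono simp: indicator_def)
    then have "(\<integral>x. f x \<partial>uniform_measure M A) = 0"
      by (rule integral_eq_zero_AE)
    then show ?thesis using True by simp
  next
    case False
    then have "indicator A x / emeasure M A = ennreal (indicator A x / measure M A)" for x
      by (simp add: emeasure_eq_measure divide_ennreal indicator_def zero_less_measure_iff
          flip: ennreal_1)
    then have "(\<integral>x. f x \<partial>uniform_measure M A) = (\<integral>x. (indicator A x / measure M A) * f x \<partial>M)"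
      unfolding uniform_measure_def using assms by (simp add: integral_density)
    also have "\<dots> = (\<integral>x. (f x * indicator A x) / measure M A \<partial>M)"
      by (intro Bochner_Integration.integral_cong) auto
    finally show ?thesis by simp
  qed
qed

text \<open>The law \<mu> is a parameter rather than a process, so that conditional means taken
  under the motion behind the ascent can be used for \<open>W\<close>, whose path law is the
  same.\<close>

locale bounded_path_functional =
  fixes f :: "(unit_interval \<Rightarrow>\<^sub>C real) \<Rightarrow> real" and c :: real and \<mu> :: "(unit_interval \<Rightarrow>\<^sub>C real) measure"
  assumes measurable_functional [measurable]: "f \<in> borel_measurable borel"
    and functional_bound: "\<And>p. \<bar>f p\<bar> \<le> c"
    and prob_space_paths: "prob_space \<mu>"
    and sets_paths: "sets \<mu> = sets borel"
begin

sublocale paths: prob_space \<mu> by (rule prob_space_paths)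

lemma measurable_paths [measurable_cong]: "sets \<mu> = sets borel"
  by (rule sets_paths)

text \<open>
  The conditional mean of \<open>f\<close> given a drawdown below \<open>x\<close>; it is 0 if this event is null, which
  agrees with integration against \<^const>\<open>uniform_measure\<close> on a null set.
\<close>

definition small_drawdown_mean :: "real \<Rightarrow> real"
  where "small_drawdown_mean x =
    (\<integral>p. f p * indicator {p. drawdown p < x} p \<partial>\<mu>) / measure \<mu> {p. drawdown p < x}"

lemma sets_small_drawdown [measurable]: "{p. drawdown p < x} \<in> sets borel"
  by measurable

lemma integrable_functional: "A \<in> sets borel \<Longrightarrow> integrable \<mu> (\<lambda>p. f p * indicator A p)"
  using functional_bound order_trans[OF abs_ge_zero functional_bound]
  by (intro paths.integrable_const_bound[where B=c]) (auto simp: indicator_def)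

lemma abs_integral_functional_le:
  assumes A: "A \<in> sets borel"
  shows "\<bar>\<integral>p. f p * indicator A p \<partial>\<mu>\<bar> \<le> c * measure \<mu> A"
proof -
  have [measurable]: "A \<in> sets borel" by fact
  have "\<bar>\<integral>p. f p * indicator A p \<partial>\<mu>\<bar> \<le> (\<integral>p. \<bar>f p * indicator A p\<bar> \<partial>\<mu>)"
    by (rule integral_abs_bound)
  also have "\<dots> \<le> (\<integral>p. c * indicator A p \<partial>\<mu>)"
  proof (rule integral_mono)
    show "integrable \<mu> (\<lambda>p. \<bar>f p * indicator A p\<bar>)"
      using A by (intro integrable_abs integrable_functional)
    show "integrable \<mu> (\<lambda>p. c * indicator A p)"
      using A by (intro integrable_mult_right integrable_real_indicator) (auto simp: less_top[symmetric])
    show "\<bar>f p * indicator A p\<bar> \<le> c * indicator A p" for p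
      using functional_bound by (auto simp: indicator_def)
  qed
  also have "\<dots> = c * measure \<mu> A"
    using sets_eq_imp_space_eq[OF sets_paths] by simp
  finally show ?thesis .
qed

text \<open>Undoes the division even when the event is null: the integral is bounded by
  \<open>c\<close> times the measure of the event, so it vanishes as well.\<close>

lemma small_drawdown_mean_mult:
  "(\<integral>p. f p * indicator {p. drawdown p < x} p \<partial>\<mu>) =
    small_drawdown_mean x * measure \<mu> {p. drawdown p < x}"
  using abs_integral_functional_le[of "{p. drawdown p < x}"]
  by (cases "measure \<mu> {p. drawdown p < x} = 0") (auto simp: small_drawdown_mean_def)

lemma small_drawdown_mean_bound: "\<bar>small_drawdown_mean x\<bar> \<le> c"
proof (cases "measure \<mu> {p. drawdown p < x} = 0")
  case True
  then show ?thesis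
    using order_trans[OF abs_ge_zero functional_bound] by (simp add: small_drawdown_mean_def)
next
  case False
  then have "0 < measure \<mu> {p. drawdown p < x}"
    by (simp add: zero_less_measure_iff)
  then show ?thesis
    using abs_integral_functional_le[of "{p. drawdown p < x}"]
    by (simp add: small_drawdown_mean_def abs_divide field_simps)
qed

text \<open>Numerator and denominator are integrals of functions jointly measurable in x and p.
  Measurability in x matters because the mean is evaluated at a random threshold.\<close>

lemma measurable_small_drawdown_mean [measurable]: "small_drawdown_mean \<in> borel_measurable borel"
proof -
  have ind: "(\<lambda>z. indicat_real {p. drawdown p < fst z} (snd z)) \<in> borel_measurable (borel \<Otimes>\<^sub>M \<mu>)"
    unfolding indicator_def by measurable
  have "(\<lambda>x. \<integral>p. f p * indicator {p. drawdown p < x} p \<partial>\<mu>) \<in> borel_measurable borel"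
    using ind by (intro paths.borel_measurable_lebesgue_integral)
      (auto simp: case_prod_beta intro!: borel_measurable_times)
  moreover have "(\<lambda>x. \<integral>p. indicat_real {p. drawdown p < x} p \<partial>\<mu>) \<in> borel_measurable borel"
    using ind by (intro paths.borel_measurable_lebesgue_integral) (auto simp: case_prod_beta)
  then have "(\<lambda>x. measure \<mu> {p. drawdown p < x}) \<in> borel_measurable borel"
    using sets_eq_imp_space_eq[OF sets_paths] by simp
  ultimately show ?thesis
    unfolding small_drawdown_mean_def[abs_def] by (rule borel_measurable_divide)
qed

end

section \<open>The identity on one grid cell and the passage to the limit\<close>

context bounded_path_functional
begin

text \<open>With the future frozen, the past is restricted only by a drawdown bound that is now
  constant, so \<open>f\<close> may be replaced by its conditional mean under this bound. Freezing
  and unfreezing are both \<open>expectation_indep_var\<close>.\<close>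

lemma cell_expectation:
  fixes M :: "'a measure" and K :: "real set"
  assumes W: "standard_brownian_motion M W" and \<mu>: "\<mu> = path_law M W" and t: "0 < t" "t < 1"
  defines "R \<equiv> \<lambda>\<omega>. path_sup {0..1} (sample_path (future W t) \<omega>)"
  defines "C \<equiv> {\<omega>. drawdown (sample_path (past W t) \<omega>) < R \<omega> / sqrt t \<and>
    path_sup K (sample_path (future W t) \<omega>) = R \<omega>}"
  shows "(\<integral>\<omega>. f (sample_path (past W t) \<omega>) * indicator C \<omega> \<partial>M) =
    (\<integral>\<omega>. small_drawdown_mean (R \<omega> / sqrt t) * indicator C \<omega> \<partial>M)"
proof -
  interpret W: standard_brownian_motion M W by fact
  let ?P = "sample_path (past W t)" and ?F = "sample_path (future W t)"
  have indep: "W.indep_var borel ?P borel ?F"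
    using t by (rule W.indep_var_past_future)
  have law: "distr M borel ?P = \<mu>"
    using path_law_brownian_motion_unique[OF W W.standard_brownian_motion_past[of t]] t
    by (simp add: \<mu> path_law_def)
  \<comment> \<open>\<open>C\<close> factors into \<open>D\<close>, which couples past and future
    through the drawdown bound, and \<open>G\<close>, which sees the future only and is a constant
    factor once the future is frozen.\<close>
  define G where "G q = indicat_real {q. path_sup K q = path_sup {0..1} q} q" for q
  define D where "D z = indicat_real {z. drawdown (fst z) < path_sup {0..1} (snd z) / sqrt t} z" for z
  have [measurable]: "G \<in> borel_measurable borel" "D \<in> borel_measurable (borel \<Otimes>\<^sub>M borel)"
    unfolding G_def[abs_def] D_def[abs_def] indicator_def by measurable
  have le_c: "\<bar>f p * D z * G q\<bar> \<le> c" "\<bar>small_drawdown_mean x * D z * G q\<bar> \<le> c" for p q x z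
    using functional_bound[of p] small_drawdown_mean_bound[of x]
      order_trans[OF abs_ge_zero functional_bound]
    by (auto simp: D_def G_def indicator_def)
  have split: "indicator C \<omega> = D (?P \<omega>, ?F \<omega>) * G (?F \<omega>)" for \<omega>
    by (auto simp: C_def R_def D_def G_def indicator_def)
  have inner: "(\<integral>p. f p * D (p, q) * G q \<partial>\<mu>) =
    (\<integral>p. small_drawdown_mean (path_sup {0..1} q / sqrt t) * D (p, q) * G q \<partial>\<mu>)" for q
  proof -
    have D: "D (p, q) = indicator {p. drawdown p < path_sup {0..1} q / sqrt t} p" for p
      by (simp add: D_def indicator_def)
    show ?thesis
      using sets_eq_imp_space_eq[OF sets_paths] unfolding D
      by (simp add: small_drawdown_mean_mult)
  qed
  have "W.expectation (\<lambda>\<omega>. f (?P \<omega>) * D (?P \<omega>, ?F \<omega>) * G (?F \<omega>)) =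
    W.expectation (\<lambda>\<omega>. \<integral>p. f p * D (p, ?F \<omega>) * G (?F \<omega>) \<partial>\<mu>)"
    using W.expectation_indep_var[OF indep, where c=c and h="\<lambda>z. f (fst z) * D z * G (snd z)"]
    by (simp add: law le_c)
  also have "\<dots> = W.expectation (\<lambda>\<omega>. \<integral>p. small_drawdown_mean (R \<omega> / sqrt t) * D (p, ?F \<omega>) * G (?F \<omega>) \<partial>\<mu>)"
    unfolding inner R_def ..
  also have "\<dots> = W.expectation (\<lambda>\<omega>. small_drawdown_mean (R \<omega> / sqrt t) * D (?P \<omega>, ?F \<omega>) * G (?F \<omega>))"
    using W.expectation_indep_var[OF indep, where c=c and
        h="\<lambda>z. small_drawdown_mean (path_sup {0..1} (snd z) / sqrt t) * D z * G (snd z)"]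
    by (simp add: law le_c R_def)
  finally show ?thesis
    by (simp add: split mult.assoc)
qed

end

text \<open>By uniqueness, an interval reaches the global maximum iff it contains \<theta>. The
  strict inequality fails when \<theta> \<le> t, including \<theta> = t where both maxima agree, so
  the cell is open on the left; the equality rules out \<theta> > t'.\<close>

lemma (in continuous_process) arg_max_cell_iff:
  assumes \<omega>: "\<omega> \<in> space M" and \<theta>: "\<theta> \<in> {0..1}"
    and max: "\<And>s. s \<in> {0..1} \<Longrightarrow> X s \<omega> \<le> X \<theta> \<omega>"
    and unique: "\<And>s. s \<in> {0..1} \<Longrightarrow> X s \<omega> = X \<theta> \<omega> \<Longrightarrow> s = \<theta>"
    and t: "0 < t" "t < t'" "t' \<le> 1"
  shows "max_on X 0 t \<omega> < max_on X t 1 \<omega> \<and> max_on X t t' \<omega> = max_on X t 1 \<omega> \<longleftrightarrow> \<theta> \<in> {t<..t'}"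
proof -
  have eq: "max_on X a b \<omega> = X \<theta> \<omega>" if "\<theta> \<in> {a..b}" "0 \<le> a" "b \<le> 1" for a b
    using that max by (intro max_on_eqI) auto
  have less: "max_on X a b \<omega> < X \<theta> \<omega>" if ab: "\<theta> \<notin> {a..b}" "0 \<le> a" "a \<le> b" "b \<le> 1" for a b
  proof -
    obtain r where r: "r \<in> {a..b}" "max_on X a b \<omega> = X r \<omega>"
      using max_on_attained[OF ab(2-4) \<omega>] by metis
    then have "r \<in> {0..1}" "r \<noteq> \<theta>" using ab by auto
    then show ?thesis using max[of r] unique[of r] r(2) by fastforce
  qed
  consider "\<theta> \<le> t" | "t < \<theta>" "\<theta> \<le> t'" | "t' < \<theta>" by linarith
  then show ?thesis
  proof cases
    case 1
    then have "max_on X 0 t \<omega> = X \<theta> \<omega>" "max_on X t 1 \<omega> \<le> X \<theta> \<omega>"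
      using \<theta> t eq[of 0 t] eq[of t 1] less[of t 1] by (auto, cases "t = \<theta>") auto
    then show ?thesis using 1 by auto
  next
    case 2
    then show ?thesis
      using \<theta> t eq[of t 1] eq[of t t'] less[of 0 t] by auto
  next
    case 3
    then show ?thesis
      using \<theta> t eq[of t 1] less[of t t'] by auto
  qed
qed

context bounded_path_functional
begin

lemma expectation_path_to_arg_max:
  assumes W: "standard_brownian_motion M W" and \<mu>: "\<mu> = path_law M W"
    and \<Theta>: "\<Theta> \<in> borel_measurable M"
    and \<Theta>_max: "AE \<omega> in M. is_arg_max (\<lambda>s. W s \<omega>) (\<lambda>s. s \<in> {0..1}) (\<Theta> \<omega>)"
    and f_cont: "continuous_on UNIV f"
    and lim: "(small_drawdown_mean \<longlongrightarrow> \<alpha>) (at_right 0)"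
    and path_meas: "(\<lambda>\<omega>. sample_path (past W (\<Theta> \<omega>)) \<omega>) \<in> borel_measurable M"
  shows "(\<integral>\<omega>. f (sample_path (past W (\<Theta> \<omega>)) \<omega>) \<partial>M) = \<alpha>"
proof -
  interpret W: standard_brownian_motion M W by fact
  note [measurable] = \<Theta> path_meas W.measurable_sample_path
  \<comment> \<open>The maximum is almost surely positive while W starts at 0, so \<Theta> is not
    0.\<close>
  have good: "AE \<omega> in M. \<omega> \<in> space M \<and> 0 < \<Theta> \<omega> \<and> \<Theta> \<omega> \<le> 1 \<and>
    (\<forall>s\<in>{0..1}. W s \<omega> \<le> W (\<Theta> \<omega>) \<omega>) \<and> (\<forall>s\<in>{0..1}. W s \<omega> = W (\<Theta> \<omega>) \<omega> \<longrightarrow> s = \<Theta> \<omega>)"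
    using \<Theta>_max W.AE_unique_arg_max W.AE_max_on_pos W.starts_at_zero AE_space
  proof eventually_elim
    case (elim \<omega>)
    have \<Theta>: "\<Theta> \<omega> \<in> {0..1}" "\<forall>s\<in>{0..1}. W s \<omega> \<le> W (\<Theta> \<omega>) \<omega>"
      using elim(1) by (auto simp: is_arg_max_def not_less)
    then have max: "max_on W 0 1 \<omega> = W (\<Theta> \<omega>) \<omega>"
      by (intro max_on_eqI) auto
    have "\<Theta> \<omega> \<noteq> 0"
      using elim(3,4) max by auto
    moreover have "\<forall>s\<in>{0..1}. W s \<omega> = W (\<Theta> \<omega>) \<omega> \<longrightarrow> s = \<Theta> \<omega>"
      using elim(2) \<Theta>(1) max by simp
    ultimately show ?case
      using \<Theta> elim(5) by auto
  qed
  define cell :: "nat \<Rightarrow> nat \<Rightarrow> real set"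
    where "cell n k = {real k / real n<..real (Suc k) / real n}" for n k
  have [measurable]: "cell n k \<in> sets borel" for n k
    by (simp add: cell_def)
  define A where "A \<omega> t = f (sample_path (past W t) \<omega>)" for \<omega> t
  \<comment> \<open>The threshold is written with the global maximum instead of the maximum over
    [t,1]. They agree whenever \<Theta> lies in the cell after t, and in this form the limit as t
    increases to \<Theta> follows from continuity of W alone.\<close>
  define B where "B \<omega> t = small_drawdown_mean ((path_sup {0..1} (sample_path W \<omega>) - W t \<omega>) / sqrt t)" for \<omega> t
  have A_bound: "\<bar>A \<omega> t\<bar> \<le> c" and B_bound: "\<bar>B \<omega> t\<bar> \<le> c" for \<omega> t
    unfolding A_def B_def by (rule functional_bound small_drawdown_mean_bound)+
  have grid: "real k / real n \<in> {0<..<1}" if "k \<in> {1..<n}" for k n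
    using that by auto
  have A_meas [measurable]: "(\<lambda>\<omega>. A \<omega> t) \<in> borel_measurable M" if "t \<in> {0<..<1}" for t
  proof -
    have [measurable]: "sample_path (past W t) \<in> borel_measurable M"
      using that by (intro continuous_process.measurable_sample_path W.continuous_process_past) auto
    show ?thesis unfolding A_def by measurable
  qed
  have B_meas [measurable]: "(\<lambda>\<omega>. B \<omega> t) \<in> borel_measurable M" if "t \<in> {0<..<1}" for t
  proof -
    have [measurable]: "W t \<in> borel_measurable M"
      using that by (intro W.measurable_process) auto
    show ?thesis unfolding B_def by measurable
  qed
  have int: "integrable M (\<lambda>\<omega>. F \<omega> * indicator (cell n k) (\<Theta> \<omega>))"
    if [measurable]: "F \<in> borel_measurable M" and "\<And>\<omega>. \<bar>F \<omega>\<bar> \<le> c" for F :: "_ \<Rightarrow> real" and n k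
    using that(2) order_trans[OF abs_ge_zero functional_bound]
    by (intro W.integrable_const_bound[where B=c]) (auto simp: indicator_def)
  have cell_eq: "(\<integral>\<omega>. A \<omega> (real k / real n) * indicator (cell n k) (\<Theta> \<omega>) \<partial>M) =
    (\<integral>\<omega>. B \<omega> (real k / real n) * indicator (cell n k) (\<Theta> \<omega>) \<partial>M)" if k: "k \<in> {1..<n}" for n k
  proof -
    define t t' where "t = real k / real n" and "t' = real (Suc k) / real n"
    have t: "0 < t" "t < 1" "t < t'" "t' \<le> 1"
      using k by (auto simp: t_def t'_def field_simps)
    have cell: "cell n k = {t<..t'}"
      by (simp add: cell_def t_def t'_def)
    let ?P = "sample_path (past W t)" and ?F = "sample_path (future W t)"
    \<comment> \<open>The interval [t,t'] on the clock of the future at t.\<close>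
    let ?K = "{0..(t' - t) / (1 - t)}"
    define C where "C = {\<omega>. drawdown (?P \<omega>) < path_sup {0..1} (?F \<omega>) / sqrt t \<and>
      path_sup ?K (?F \<omega>) = path_sup {0..1} (?F \<omega>)}"
    have [measurable]: "?P \<in> borel_measurable M" "?F \<in> borel_measurable M"
      using W.indep_var_past_future[of t] t by (auto simp: W.indep_var_eq)
    have ind [measurable]: "indicat_real C \<in> borel_measurable M"
      unfolding C_def indicator_def by measurable
    have pathwise: "AE \<omega> in M. indicat_real C \<omega> = indicator (cell n k) (\<Theta> \<omega>) \<and>
      (\<omega> \<in> C \<longrightarrow> path_sup {0..1} (?F \<omega>) = path_sup {0..1} (sample_path W \<omega>) - W t \<omega>)"
      using good
    proof eventually_elim
      case (elim \<omega>)
      then have \<omega>: "\<omega> \<in> space M" by simp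
      have F: "path_sup {0..1} (?F \<omega>) = max_on W t 1 \<omega> - W t \<omega>"
        "path_sup ?K (?F \<omega>) = max_on W t t' \<omega> - W t \<omega>"
        using W.path_sup_future[of t t 1 \<omega>] W.path_sup_future[of t t t' \<omega>] t \<omega> by auto
      have "\<omega> \<in> C \<longleftrightarrow> max_on W 0 t \<omega> < max_on W t 1 \<omega> \<and> max_on W t t' \<omega> = max_on W t 1 \<omega>"
        using t \<omega> by (simp add: C_def F W.drawdown_past divide_less_cancel)
      also have "\<dots> \<longleftrightarrow> \<Theta> \<omega> \<in> cell n k"
        unfolding cell using elim t by (intro W.arg_max_cell_iff) auto
      finally have iff: "\<omega> \<in> C \<longleftrightarrow> \<Theta> \<omega> \<in> cell n k" .
      moreover have "max_on W t 1 \<omega> = max_on W 0 1 \<omega>" if "\<Theta> \<omega> \<in> cell n k"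
      proof -
        have "max_on W t 1 \<omega> = W (\<Theta> \<omega>) \<omega>" "max_on W 0 1 \<omega> = W (\<Theta> \<omega>) \<omega>"
          using that elim t by (intro max_on_eqI; auto simp: cell)+
        then show ?thesis by simp
      qed
      ultimately show ?case
        by (auto simp: indicator_def F W.path_sup_sample_path[OF \<omega>])
    qed
    have tt: "t \<in> {0<..<1}" using t by auto
    note [measurable] = A_meas[OF tt] B_meas[OF tt]
    have "(\<integral>\<omega>. A \<omega> t * indicator (cell n k) (\<Theta> \<omega>) \<partial>M) = (\<integral>\<omega>. f (?P \<omega>) * indicator C \<omega> \<partial>M)"
      using pathwise by (intro integral_cong_AE) (auto simp: A_def elim!: eventually_mono)
    also have "\<dots> = (\<integral>\<omega>. small_drawdown_mean (path_sup {0..1} (?F \<omega>) / sqrt t) * indicator C \<omega> \<partial>M)"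
      unfolding C_def by (rule cell_expectation[OF W \<mu> t(1,2)])
    also have "\<dots> = (\<integral>\<omega>. B \<omega> t * indicator (cell n k) (\<Theta> \<omega>) \<partial>M)"
    proof (rule integral_cong_AE)
      show "AE \<omega> in M. small_drawdown_mean (path_sup {0..1} (?F \<omega>) / sqrt t) * indicator C \<omega> =
        B \<omega> t * indicator (cell n k) (\<Theta> \<omega>)"
        using pathwise
      proof eventually_elim
        case (elim \<omega>)
        then show ?case by (cases "\<omega> \<in> C") (auto simp: B_def)
      qed
    qed measurable
    finally show ?thesis by (simp add: t_def)
  qed
  define S where "S F n \<omega> = (\<Sum>k=1..<n. F \<omega> (real k / real n) * indicator (cell n k) (\<Theta> \<omega>))"
    for F :: "_ \<Rightarrow> real \<Rightarrow> real" and n \<omega>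
  have S_lim: "(\<lambda>n. \<integral>\<omega>. S F n \<omega> \<partial>M) \<longlonglongrightarrow> (\<integral>\<omega>. L \<omega> \<partial>M)"
    if meas: "\<And>t. t \<in> {0<..<1} \<Longrightarrow> (\<lambda>\<omega>. F \<omega> t) \<in> borel_measurable M" and bound: "\<And>\<omega> t. \<bar>F \<omega> t\<bar> \<le> c"
      and [measurable]: "L \<in> borel_measurable M"
      and conv: "AE \<omega> in M. (F \<omega> \<longlongrightarrow> L \<omega>) (at_left (\<Theta> \<omega>))"
    for F and L :: "_ \<Rightarrow> real"
  proof (rule integral_dominated_convergence[where w="\<lambda>_. c"])
    show "S F n \<in> borel_measurable M" for n
      unfolding S_def[abs_def]
    proof (rule borel_measurable_sum)
      fix k assume "k \<in> {1..<n}"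
      then have [measurable]: "(\<lambda>\<omega>. F \<omega> (real k / real n)) \<in> borel_measurable M"
        by (intro meas grid)
      show "(\<lambda>\<omega>. F \<omega> (real k / real n) * indicator (cell n k) (\<Theta> \<omega>)) \<in> borel_measurable M"
        by measurable
    qed
    show "AE \<omega> in M. (\<lambda>n. S F n \<omega>) \<longlonglongrightarrow> L \<omega>"
      using conv good
      unfolding S_def cell_def by eventually_elim (rule sum_grid_cells_tendsto; simp)
    show "AE \<omega> in M. norm (S F n \<omega>) \<le> c" for n
      unfolding S_def cell_def real_norm_def by (rule AE_I2, rule sum_grid_cells_bound, rule bound)
  qed simp_all
  have S_eq: "(\<integral>\<omega>. S A n \<omega> \<partial>M) = (\<integral>\<omega>. S B n \<omega> \<partial>M)" for n
  proof -
    have "(\<integral>\<omega>. S A n \<omega> \<partial>M) = (\<Sum>k=1..<n. \<integral>\<omega>. A \<omega> (real k / real n) * indicator (cell n k) (\<Theta> \<omega>) \<partial>M)"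
      unfolding S_def
      by (rule Bochner_Integration.integral_sum) (rule int[OF A_meas[OF grid] A_bound])
    also have "\<dots> = (\<Sum>k=1..<n. \<integral>\<omega>. B \<omega> (real k / real n) * indicator (cell n k) (\<Theta> \<omega>) \<partial>M)"
      by (intro sum.cong refl cell_eq)
    also have "\<dots> = (\<integral>\<omega>. S B n \<omega> \<partial>M)"
      unfolding S_def
      by (rule Bochner_Integration.integral_sum[symmetric]) (rule int[OF B_meas[OF grid] B_bound])
    finally show ?thesis .
  qed
  have "(\<lambda>n. \<integral>\<omega>. S A n \<omega> \<partial>M) \<longlonglongrightarrow> (\<integral>\<omega>. f (sample_path (past W (\<Theta> \<omega>)) \<omega>) \<partial>M)"
  proof (rule S_lim[OF A_meas A_bound])
    show "AE \<omega> in M. (A \<omega> \<longlongrightarrow> f (sample_path (past W (\<Theta> \<omega>)) \<omega>)) (at_left (\<Theta> \<omega>))"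
      using good
    proof eventually_elim
      case (elim \<omega>)
      have "isCont f (sample_path (past W (\<Theta> \<omega>)) \<omega>)"
        using f_cont by (simp add: continuous_on_eq_continuous_at)
      then show ?case
        unfolding A_def[abs_def] using elim
        by (intro isCont_tendsto_compose[of _ f] W.tendsto_sample_path_past) auto
    qed
  qed measurable
  moreover have "(\<lambda>n. \<integral>\<omega>. S B n \<omega> \<partial>M) \<longlonglongrightarrow> (\<integral>\<omega>. \<alpha> \<partial>M)"
  proof (rule S_lim[OF B_meas B_bound])
    show "AE \<omega> in M. (B \<omega> \<longlongrightarrow> \<alpha>) (at_left (\<Theta> \<omega>))"
      using good
    proof eventually_elim
      case (elim \<omega>)
      then have \<omega>: "\<omega> \<in> space M" by simp
      let ?g = "\<lambda>t. (path_sup {0..1} (sample_path W \<omega>) - W t \<omega>) / sqrt t"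
      have sup: "path_sup {0..1} (sample_path W \<omega>) = W (\<Theta> \<omega>) \<omega>"
        unfolding W.path_sup_sample_path[OF \<omega>] using elim by (intro max_on_eqI) auto
      have near: "\<forall>\<^sub>F t in at_left (\<Theta> \<omega>). t \<in> {0<..<\<Theta> \<omega>}"
        using elim by (intro eventually_at_leftI[of 0]) auto
      have "((\<lambda>t. W t \<omega>) \<longlongrightarrow> W (\<Theta> \<omega>) \<omega>) (at (\<Theta> \<omega>) within {0..1})"
        using W.continuous_paths[OF \<omega>] elim by (auto simp: continuous_on_def)
      moreover have "at_left (\<Theta> \<omega>) \<le> at (\<Theta> \<omega>) within {0..1}"
      proof -
        have "at_left (\<Theta> \<omega>) = at (\<Theta> \<omega>) within {0..<\<Theta> \<omega>}"
          using elim by (intro at_within_nhd[of _ "{0<..}"]) auto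
        also have "\<dots> \<le> at (\<Theta> \<omega>) within {0..1}"
          using elim by (intro at_le) auto
        finally show ?thesis .
      qed
      ultimately have "((\<lambda>t. W t \<omega>) \<longlongrightarrow> W (\<Theta> \<omega>) \<omega>) (at_left (\<Theta> \<omega>))"
        by (rule tendsto_mono[rotated])
      then have "(?g \<longlongrightarrow> (W (\<Theta> \<omega>) \<omega> - W (\<Theta> \<omega>) \<omega>) / sqrt (\<Theta> \<omega>)) (at_left (\<Theta> \<omega>))"
        unfolding sup using elim by (intro tendsto_intros) auto
      \<comment> \<open>Uniqueness of the maximiser makes the threshold strictly positive before
        \<Theta>, so it tends to 0 from the right, the only direction in which \<open>lim\<close>
        speaks.\<close>
      moreover have "\<forall>\<^sub>F t in at_left (\<Theta> \<omega>). 0 < ?g t"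
        using near
      proof eventually_elim
        case (elim t)
        then have "t \<in> {0..1}" "t \<noteq> \<Theta> \<omega>" using \<open>\<omega> \<in> space M \<and> _\<close> by auto
        then have "W t \<omega> < W (\<Theta> \<omega>) \<omega>"
          using \<open>\<omega> \<in> space M \<and> _\<close> by (metis order_le_less)
        then show ?case unfolding sup using elim by simp
      qed
      ultimately have "filterlim ?g (at_right 0) (at_left (\<Theta> \<omega>))"
        by (auto simp: filterlim_at elim: eventually_mono)
      from filterlim_compose[OF lim this] show ?case
        unfolding B_def[abs_def] .
    qed
  qed measurable
  ultimately have "(\<integral>\<omega>. f (sample_path (past W (\<Theta> \<omega>)) \<omega>) \<partial>M) = (\<integral>\<omega>. \<alpha> \<partial>M)"
    unfolding S_eq by (rule LIMSEQ_unique)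
  then show ?thesis by (simp add: W.prob_space)
qed

end

section \<open>The rescaled path as a random element, and the transfer to the law of the
  ascent\<close>

lemma (in continuous_process) continuous_process_rescaled:
  assumes \<Theta>: "\<Theta> \<in> borel_measurable M" and range: "\<And>\<omega>. \<omega> \<in> space M \<Longrightarrow> \<Theta> \<omega> \<in> {0..1}"
  shows "continuous_process M (\<lambda>s \<omega>. X (s * \<Theta> \<omega>) \<omega> / sqrt (\<Theta> \<omega>))"
proof
  fix \<omega> assume \<omega>: "\<omega> \<in> space M"
  then show "continuous_on {0..1} (\<lambda>s. X (s * \<Theta> \<omega>) \<omega> / sqrt (\<Theta> \<omega>))"
    using continuous_process.continuous_paths[OF continuous_process_past[OF range[OF \<omega>]] \<omega>]
    by (simp add: past_def)
next
  fix s :: real assume s: "s \<in> {0..1}"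
  note [measurable] = \<Theta>
  \<comment> \<open>Evaluation at a random time is measurable as a pointwise limit of Bernstein
    polynomials of the path: each combines finitely many values at fixed times with polynomials in
    \<Theta>.\<close>
  let ?X = "\<lambda>n \<omega>. \<Sum>k\<le>n. X (real k / real n) \<omega> * Bernstein n k (s * \<Theta> \<omega>)"
  have "(\<lambda>\<omega>. X (s * \<Theta> \<omega>) \<omega>) \<in> borel_measurable M"
  proof (rule borel_measurable_LIMSEQ_real)
    fix \<omega> assume \<omega>: "\<omega> \<in> space M"
    show "(\<lambda>n. ?X n \<omega>) \<longlonglongrightarrow> X (s * \<Theta> \<omega>) \<omega>"
    proof (rule LIMSEQ_I)
      fix e :: real assume "0 < e"
      from Bernstein_Weierstrass[OF continuous_paths[OF \<omega>] this] obtain N where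
        "\<And>n x. N \<le> n \<Longrightarrow> x \<in> {0..1} \<Longrightarrow>
          \<bar>X x \<omega> - (\<Sum>k\<le>n. X (real k / real n) \<omega> * Bernstein n k x)\<bar> < e"
        by blast
      then show "\<exists>N. \<forall>n\<ge>N. norm (?X n \<omega> - X (s * \<Theta> \<omega>) \<omega>) < e"
        using past_time[OF s range[OF \<omega>]] by (auto simp: abs_minus_commute)
    qed
  next
    fix n
    show "?X n \<in> borel_measurable M"
    proof (rule borel_measurable_sum)
      fix k assume "k \<in> {..n}"
      then have [measurable]: "X (real k / real n) \<in> borel_measurable M"
        by (intro measurable_process) (auto simp: divide_le_eq_1)
      show "(\<lambda>\<omega>. X (real k / real n) \<omega> * Bernstein n k (s * \<Theta> \<omega>)) \<in> borel_measurable M"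
        unfolding Bernstein_def by measurable
    qed
  qed
  then show "(\<lambda>\<omega>. X (s * \<Theta> \<omega>) \<omega> / sqrt (\<Theta> \<omega>)) \<in> borel_measurable M"
    by measurable
qed

text \<open>The conditioning event is the preimage of a drawdown event under the sample path map, so
  conditioning on the probability space becomes conditioning on path space.\<close>

lemma (in standard_brownian_motion) small_drawdown_mean_path_law:
  assumes "bounded_path_functional f c (path_law M X)"
  shows "(\<integral>p. f p \<partial>path_law (uniform_measure M {\<omega> \<in> space M. (SUP s\<in>{0..1}. X s \<omega>) - X 1 \<omega> < x}) X) =
    bounded_path_functional.small_drawdown_mean f (path_law M X) x"
proof -
  interpret bounded_path_functional f c "path_law M X" by fact
  note [measurable] = measurable_sample_path
  let ?D = "{p. drawdown p < x}"
  have drawdown: "drawdown (sample_path X \<omega>) = (SUP s\<in>{0..1}. X s \<omega>) - X 1 \<omega>" if "\<omega> \<in> space M" for \<omega>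
    using that by (simp add: drawdown_def path_sup_sample_path sample_path_coordinate max_on_def)
  let ?A = "sample_path X -` ?D \<inter> space M"
  have A: "{\<omega> \<in> space M. (SUP s\<in>{0..1}. X s \<omega>) - X 1 \<omega> < x} = ?A"
    using drawdown by auto
  have A_ev: "?A \<in> events"
    by measurable
  have "(\<integral>p. f p \<partial>path_law (uniform_measure M ?A) X) = (\<integral>\<omega>. f (sample_path X \<omega>) \<partial>uniform_measure M ?A)"
    unfolding path_law_def by (rule integral_distr) simp_all
  also have "\<dots> = expectation (\<lambda>\<omega>. f (sample_path X \<omega>) * indicator ?A \<omega>) / prob ?A"
    by (rule integral_uniform_measure[OF finite_measure_axioms A_ev]) measurable
  also have "prob ?A = measure (path_law M X) ?D"
    unfolding path_law_def by (rule measure_distr[symmetric]) auto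
  also have "expectation (\<lambda>\<omega>. f (sample_path X \<omega>) * indicator ?A \<omega>) =
    expectation (\<lambda>\<omega>. f (sample_path X \<omega>) * indicator ?D (sample_path X \<omega>))"
    by (intro Bochner_Integration.integral_cong) (auto simp: indicator_def)
  also have "\<dots> = (\<integral>p. f p * indicator ?D p \<partial>path_law M X)"
    unfolding path_law_def by (rule integral_distr[symmetric]) auto
  finally show ?thesis
    unfolding A small_drawdown_mean_def .
qed

theorem proposition6p3:
  fixes P :: "'p measure" and X :: "real \<Rightarrow> 'p \<Rightarrow> real"
    and N :: "'n measure" and a :: "real \<Rightarrow> 'n \<Rightarrow> real"
    and M :: "'m measure" and W :: "real \<Rightarrow> 'm \<Rightarrow> real" and \<Theta> :: "'m \<Rightarrow> real"
  assumes ascent: "brownian_ascent P X N a"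
    and W: "standard_brownian_motion M W"
    and \<Theta>_measurable: "\<Theta> \<in> borel_measurable M"
    and \<Theta>_range: "\<And>\<omega>. \<omega> \<in> space M \<Longrightarrow> \<Theta> \<omega> \<in> {0..1}"
    and \<Theta>_maximises: "AE \<omega> in M. is_arg_max (\<lambda>s. W s \<omega>) (\<lambda>s. s \<in> {0..1}) (\<Theta> \<omega>)"
  shows "path_law N a = path_law M (\<lambda>s \<omega>. W (s * \<Theta> \<omega>) \<omega> / sqrt (\<Theta> \<omega>))"
proof -
  interpret X: standard_brownian_motion P X
    using ascent by (simp add: brownian_ascent_def)
  interpret a: continuous_process N a
    using ascent by (simp add: brownian_ascent_def)
  interpret W: standard_brownian_motion M W by fact
  let ?Y = "\<lambda>s \<omega>. W (s * \<Theta> \<omega>) \<omega> / sqrt (\<Theta> \<omega>)"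
  interpret Y: continuous_process M ?Y
    by (rule W.continuous_process_rescaled[OF \<Theta>_measurable \<Theta>_range])
  have Y_path: "sample_path ?Y \<omega> = sample_path (past W (\<Theta> \<omega>)) \<omega>" for \<omega>
    by (simp add: sample_path_def past_def)
  have path_meas: "(\<lambda>\<omega>. sample_path (past W (\<Theta> \<omega>)) \<omega>) \<in> borel_measurable M"
    unfolding Y_path[symmetric] by (rule Y.measurable_sample_path)
  show ?thesis
  proof (rule measure_eqI_bounded_continuous)
    show "finite_measure (path_law N a)" "finite_measure (path_law M ?Y)"
      using a.prob_space_path_law Y.prob_space_path_law by (simp_all add: prob_space_def)
    show "sets (path_law N a) = sets borel" "sets (path_law M ?Y) = sets borel"
      by (simp_all add: path_law_def)
    fix f :: "(unit_interval \<Rightarrow>\<^sub>C real) \<Rightarrow> real"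
    assume f: "continuous_on UNIV f" "bounded (range f)"
    then obtain c where c: "\<And>p. \<bar>f p\<bar> \<le> c"
      by (auto simp: bounded_iff)
    interpret bounded_path_functional f c "path_law P X"
    proof (rule bounded_path_functional.intro)
      show "f \<in> borel_measurable borel" by (rule borel_measurable_continuous_onI[OF f(1)])
      show "prob_space (path_law P X)" by (rule X.prob_space_path_law)
      show "\<bar>f p\<bar> \<le> c" for p by (rule c)
      show "sets (path_law P X) = sets borel" by (simp add: path_law_def)
    qed
    have "((\<lambda>\<epsilon>. \<integral>p. f p \<partial>path_law (uniform_measure P
        {\<omega> \<in> space P. (SUP s\<in>{0..1}. X s \<omega>) - X 1 \<omega> < \<epsilon>}) X) \<longlongrightarrow> (\<integral>p. f p \<partial>path_law N a)) (at_right 0)"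
      by (rule ascent[unfolded brownian_ascent_def converges_weakly_def, THEN conjunct2, THEN conjunct2,
            rule_format, OF conjI[OF f]])
    then have "(small_drawdown_mean \<longlongrightarrow> (\<integral>p. f p \<partial>path_law N a)) (at_right 0)"
      unfolding X.small_drawdown_mean_path_law[OF bounded_path_functional_axioms] .
    then have "(\<integral>\<omega>. f (sample_path (past W (\<Theta> \<omega>)) \<omega>) \<partial>M) = (\<integral>p. f p \<partial>path_law N a)"
      \<comment> \<open>Here \<alpha> is the integral of \<open>f\<close> under the ascent.
        Uniqueness of the Brownian path law identifies the \<mu> built from X with the path law of
        \<open>W\<close>.\<close>
      by (intro expectation_path_to_arg_max[OF W _ \<Theta>_measurable \<Theta>_maximises f(1) _ path_meas]
          path_law_brownian_motion_unique X.standard_brownian_motion_axioms W)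
    also have "(\<integral>\<omega>. f (sample_path (past W (\<Theta> \<omega>)) \<omega>) \<partial>M) = (\<integral>p. f p \<partial>path_law M ?Y)"
      unfolding path_law_def Y_path[symmetric]
      by (rule integral_distr[symmetric, OF Y.measurable_sample_path measurable_functional])
    finally show "(\<integral>p. f p \<partial>path_law N a) = (\<integral>p. f p \<partial>path_law M ?Y)" ..
  qed
qed

end
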